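(* Let $(A,\alpha)$ be an amenable C*-dynamical system for an action of a topological semigroup $G$, with $G$ unimodular with respect to the measure $\rho$, and let $(f_\iota)$ be both a right and a left averaging net for $(G,A)$. Then statements (i) to (vi) below are equivalent. (i) The system $(A,\alpha)$ is uniquely ergodic relative to $A^\alpha$. (ii) The limit $\lim_\iota \frac{1}{\int f_\iota\,d\rho}\int f_\iota(g)\,\alpha_g(a)\,dg$ exists (in norm) for every $a\in A$. (iii) The subspace $A^\alpha+\operatorname{span}\{a-\alpha_g(a): g\in G, a\in A\}$ is (norm) dense in $A$. (iv) The equality $A=A^\alpha+\overline{\operatorname{span}\{a-\alpha_g(a): g\in G, a\in A\}}$ holds (norm closure). (v) Every bounded linear functional on $A^\alpha$ has a unique bounded $\alpha$-invariant extension to $A$ with the same norm. (vi) There is a positive projection $E$ of $A$ onto some operator system $B$ of $A$ such that for every $a\in A$ and every state $\varphi$ on $A$ one has $$\lim_\iota \frac{1}{\int f_\iota\,d\rho}\int f_\iota(g)\,\varphi(\alpha_g(a))\,dg=\varphi(E(a))$$ (in which case necessarily $B=A^\alpha$ and $\alpha_g\circ E=E=E\circ\alpha_g$ for all $g\in G$). Furthermore, statements (i) to (vi) imply the following statements: (vii) There exists a unique $\alpha$-invariant positive projection $E$ from $A$ onto $A^\alpha$. (viii) The positive projection $E$ in (vii) is given by $$Ea=\lim_\iota \frac{1}{\int f_\iota\,d\rho}\int f_\iota(g)\,\alpha_g(a)\,dg$$ for all $a\in A$ (limit in norm).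
   Context: Integrals of Banach space valued functions are Bochner integrals; $dg$ denotes integration over $G$ with respect to $\rho$. Averaging nets: Let $G$ be a topological semigroup (not necessarily with identity) with a right invariant measure $\rho$ on its Borel $\sigma$-algebra and let $X$ be a Banach space. A net $(f_\iota)_{\iota\in I}$ with $f_\iota\in L^1(\rho)$, $f_\iota:G\to[0,\infty)$, $\int f_\iota\,d\rho\neq0$, is a (right) averaging net for $(G,X)$ if $f_\iota F$ is Bochner integrable for all bounded Borel measurable $F:G\to X$ and, for all such $F$ and all $h\in G$, $\lim_\iota \frac{\int f_\iota(g)[F(g)-F(gh)]\,dg}{\int f_\iota\,d\rho}=0$ in norm. It is a left averaging net if instead the last condition holds with $F(hg)$ in place of $F(gh)$. A C*-dynamical system $(A,\alpha)$ consists of a unital C*-algebra $A$ and an action $\alpha$ of a semigroup $G$ on $A$ by unital completely positive maps $\alpha_g:A\to A$. It is amenable if $G$ is a topological semigroup with a right invariant measure $\rho$ on its Borel $\sigma$-algebra, $(G,A)$ has an averaging net, and $g\mapsto\alpha_g(a)$ is Borel measurable $G\to A$ for every $a\in A$. $G$ is unimodular with respect to $\rho$ if the right invariant measure $\rho$ is also left invariant. The fixed point operator system is $A^\alpha:=\{a\in A:\alpha_g(a)=a\text{ for all }g\in G\}$. An operator system of $A$ is a norm closed self-adjoint vector subspace of $A$ containing the unit of $A$. A state $\mu$ on $A$ is invariant if $\mu\circ\alpha_g=\mu$ for all $g\in G$; a linear functional or a positive projection $E$ is $\alpha$-invariant if its composition with $\alpha_g$ on the right equals itself (e.g. $E\circ\alpha_g=E$)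 for all $g\in G$. The system $(A,\alpha)$ is uniquely ergodic relative to $A^\alpha$ if every state on $A^\alpha$ has a unique extension to an invariant state of $(A,\alpha)$. *)

theory Defs
  imports "HOL-Analysis.Analysis"
begin

section \<open>Unital C*-algebras\<close>

text \<open>The superclass \<^class>\<open>real_normed_algebra_1\<close> contributes \<^prop>\<open>(0::'a::real_normed_algebra_1) \<noteq> 1\<close>,
  so only the zero algebra is excluded.\<close>

class unital_cstar_algebra = real_normed_algebra_1 + banach +
  fixes scaleC :: "complex \<Rightarrow> 'a \<Rightarrow> 'a"  (infixr \<open>*\<^sub>C\<close> 75)
    and star :: "'a \<Rightarrow> 'a"
  assumes scaleC_add_right: "c *\<^sub>C (a + b) = c *\<^sub>C a + c *\<^sub>C b"
    and scaleC_add_left: "(c + d) *\<^sub>C a = c *\<^sub>C a + d *\<^sub>C a"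
    and scaleC_scaleC: "c *\<^sub>C (d *\<^sub>C a) = (c * d) *\<^sub>C a"
    and scaleR_scaleC: "scaleR r a = complex_of_real r *\<^sub>C a"
    and norm_scaleC: "norm (c *\<^sub>C a) = cmod c * norm a"
    and mult_scaleC_left: "(c *\<^sub>C a) * b = c *\<^sub>C (a * b)"
    and mult_scaleC_right: "a * (c *\<^sub>C b) = c *\<^sub>C (a * b)"
    and star_star: "star (star a) = a"
    and star_add: "star (a + b) = star a + star b"
    and star_scaleC: "star (c *\<^sub>C a) = cnj c *\<^sub>C star a"
    and star_mult: "star (a * b) = star b * star a"
    and cstar_identity: "norm (star a * a) = (norm a)\<^sup>2"

instantiation complex :: unital_cstar_algebra
begin

definition scaleC_complex_def: "scaleC = ((*) :: complex \<Rightarrow> complex \<Rightarrow> complex)"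

definition star_complex_def: "star = cnj"

instance
  by standard
    (simp_all add: scaleC_complex_def star_complex_def algebra_simps norm_mult
      scaleR_conv_of_real power2_eq_square)

end

global_interpretation complex_vector: vector_space "scaleC :: complex \<Rightarrow> 'a \<Rightarrow> 'a::unital_cstar_algebra"
  defines cspan = complex_vector.span
    and csubspace = complex_vector.subspace
proof unfold_locales
  show "1 *\<^sub>C a = a" for a :: 'a
    using scaleR_scaleC[of 1 a] by simp
qed (rule scaleC_add_right scaleC_add_left scaleC_scaleC)+

definition cstar_positive :: "'a::unital_cstar_algebra \<Rightarrow> bool" where
  "cstar_positive a \<longleftrightarrow> (\<exists>x. a = star x * x)"

text \<open>The matrix algebra $M_n(A)$ is represented by functions of two indices below \<open>n\<close>;
  the right-hand side reads $M = X^* X$.\<close>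

definition matrix_positive :: "nat \<Rightarrow> (nat \<Rightarrow> nat \<Rightarrow> 'a::unital_cstar_algebra) \<Rightarrow> bool" where
  "matrix_positive n M \<longleftrightarrow>
     (\<exists>X. \<forall>i<n. \<forall>j<n. M i j = (\<Sum>k<n. star (X k i) * X k j))"

definition clinear_on :: "'a::unital_cstar_algebra set \<Rightarrow> ('a \<Rightarrow> 'b::unital_cstar_algebra) \<Rightarrow> bool" where
  "clinear_on B T \<longleftrightarrow>
     (\<forall>a\<in>B. \<forall>b\<in>B. T (a + b) = T a + T b) \<and> (\<forall>c. \<forall>a\<in>B. T (c *\<^sub>C a) = c *\<^sub>C T a)"

definition completely_positive :: "('a::unital_cstar_algebra \<Rightarrow> 'a) \<Rightarrow> bool" where
  "completely_positive T \<longleftrightarrow> clinear_on UNIV T \<and>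
     (\<forall>n M. matrix_positive n M \<longrightarrow> matrix_positive n (\<lambda>i j. T (M i j)))"

definition operator_system :: "'a::unital_cstar_algebra set \<Rightarrow> bool" where
  "operator_system B \<longleftrightarrow> csubspace B \<and> closed B \<and> 1 \<in> B \<and> (\<forall>b\<in>B. star b \<in> B)"

definition positive_projection_onto :: "'a::unital_cstar_algebra set \<Rightarrow> ('a \<Rightarrow> 'a) \<Rightarrow> bool" where
  "positive_projection_onto B E \<longleftrightarrow>
     clinear_on UNIV E \<and> (\<forall>a. cstar_positive a \<longrightarrow> cstar_positive (E a)) \<and>
     E \<circ> E = E \<and> range E = B"

text \<open>A functional on a subspace \<open>B\<close> is a function on the whole algebra of which only the values
  on \<open>B\<close> matter.\<close>

definition state_on :: "'a::unital_cstar_algebra set \<Rightarrow> ('a \<Rightarrow> complex) \<Rightarrow> bool" where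
  "state_on B \<mu> \<longleftrightarrow>
     clinear_on B \<mu> \<and> (\<forall>a\<in>B. cstar_positive a \<longrightarrow> \<mu> a \<in> \<real>\<^sub>\<ge>\<^sub>0) \<and> \<mu> 1 = 1"

definition bounded_functional_on :: "'a::unital_cstar_algebra set \<Rightarrow> ('a \<Rightarrow> complex) \<Rightarrow> bool" where
  "bounded_functional_on B \<omega> \<longleftrightarrow> clinear_on B \<omega> \<and> (\<exists>K. \<forall>a\<in>B. cmod (\<omega> a) \<le> K * norm a)"

definition functional_norm_on :: "'a::unital_cstar_algebra set \<Rightarrow> ('a \<Rightarrow> complex) \<Rightarrow> real" where
  "functional_norm_on B \<omega> = (SUP a\<in>{a\<in>B. norm a \<le> 1}. cmod (\<omega> a))"


section \<open>Bochner integration without second countability\<close>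

text \<open>The library's \<^const>\<open>has_bochner_integral\<close> is confined to second countable, hence separable,
  target spaces. Here the integrand is only required to be an almost everywhere limit of simple
  functions, because in a non-separable space the difference of two Borel measurable functions
  need not be Borel measurable. For such functions the norms below are measurable for the
  completion of \<open>M\<close>, so that \<^const>\<open>nn_integral\<close> is additive on them.\<close>

definition has_banach_integral ::
    "'g measure \<Rightarrow> ('g \<Rightarrow> 'x::real_normed_vector) \<Rightarrow> 'x \<Rightarrow> bool" where
  "has_banach_integral M F x \<longleftrightarrow>
     (\<exists>s. (\<forall>i::nat. Bochner_Integration.simple_bochner_integrable M (s i)) \<and>
          (AE g in M. (\<lambda>i. s i g) \<longlonglongrightarrow> F g) \<and>
          (\<lambda>i. \<integral>\<^sup>+ g. norm (F g - s i g) \<partial>M) \<longlonglongrightarrow> 0 \<and>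
          (\<lambda>i. Bochner_Integration.simple_bochner_integral M (s i)) \<longlonglongrightarrow> x)"

definition banach_integrable :: "'g measure \<Rightarrow> ('g \<Rightarrow> 'x::real_normed_vector) \<Rightarrow> bool" where
  "banach_integrable M F \<longleftrightarrow> (\<exists>x. has_banach_integral M F x)"

definition banach_integral :: "'g measure \<Rightarrow> ('g \<Rightarrow> 'x::real_normed_vector) \<Rightarrow> 'x" where
  "banach_integral M F = (THE x. has_banach_integral M F x)"


section \<open>Invariant measures and averaging nets\<close>

text \<open>Translates $Sg$ of Borel sets need not be Borel in a semigroup, and \<^const>\<open>emeasure\<close> vanishes on
  non-measurable sets; hence the guard.\<close>

definition right_invariant_measure :: "'g::topological_semigroup_mult measure \<Rightarrow> bool" where
  "right_invariant_measure \<rho> \<longleftrightarrow> sets \<rho> = sets borel \<and>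
     (\<forall>g. \<forall>S\<in>sets borel. (\<lambda>h. h * g) ` S \<in> sets borel \<longrightarrow>
        emeasure \<rho> ((\<lambda>h. h * g) ` S) = emeasure \<rho> S)"

definition left_invariant_measure :: "'g::topological_semigroup_mult measure \<Rightarrow> bool" where
  "left_invariant_measure \<rho> \<longleftrightarrow> sets \<rho> = sets borel \<and>
     (\<forall>g. \<forall>S\<in>sets borel. (\<lambda>h. g * h) ` S \<in> sets borel \<longrightarrow>
        emeasure \<rho> ((\<lambda>h. g * h) ` S) = emeasure \<rho> S)"

definition directed_index :: "'i set \<Rightarrow> ('i \<Rightarrow> 'i \<Rightarrow> bool) \<Rightarrow> bool" where
  "directed_index I le \<longleftrightarrow> I \<noteq> {} \<and> (\<forall>i\<in>I. le i i) \<and>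
     (\<forall>i\<in>I. \<forall>j\<in>I. \<forall>k\<in>I. le i j \<longrightarrow> le j k \<longrightarrow> le i k) \<and>
     (\<forall>i\<in>I. \<forall>j\<in>I. \<exists>k\<in>I. le i k \<and> le j k)"

text \<open>Convergence of a net is convergence along the filter of its tails.\<close>

definition net_filter :: "'i set \<Rightarrow> ('i \<Rightarrow> 'i \<Rightarrow> bool) \<Rightarrow> 'i filter" where
  "net_filter I le = (INF i\<in>I. principal {j\<in>I. le i j})"

lemma eventually_net_filter:
  assumes "directed_index I le"
  shows "eventually P (net_filter I le) \<longleftrightarrow> (\<exists>i\<in>I. \<forall>j\<in>I. le i j \<longrightarrow> P j)"
proof -
  have "eventually P (net_filter I le) \<longleftrightarrow> (\<exists>i\<in>I. eventually P (principal {j\<in>I. le i j}))"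
    unfolding net_filter_def
  proof (rule eventually_INF_base)
    show "I \<noteq> {}" using assms by (simp add: directed_index_def)
  next
    fix i j assume ij: "i \<in> I" "j \<in> I"
    then obtain k where k: "k \<in> I" "le i k" "le j k"
      using assms unfolding directed_index_def by blast
    have "{l\<in>I. le k l} \<subseteq> {l\<in>I. le i l} \<inter> {l\<in>I. le j l}"
      using assms ij k unfolding directed_index_def by blast
    then show "\<exists>k\<in>I. principal {l\<in>I. le k l} \<le>
        inf (principal {l\<in>I. le i l}) (principal {l\<in>I. le j l})"
      using k by (intro bexI[of _ k]) (auto simp: inf_principal)
  qed
  then show ?thesis by (auto simp: eventually_principal)
qed

text \<open>Only the real structure of the Banach space \<open>'x\<close> enters.\<close>

definition integrable_net :: "'x::banach itself \<Rightarrow> 'g::topological_semigroup_mult measure \<Rightarrow>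
    'i set \<Rightarrow> ('i \<Rightarrow> 'i \<Rightarrow> bool) \<Rightarrow> ('i \<Rightarrow> 'g \<Rightarrow> real) \<Rightarrow> bool" where
  "integrable_net (_ :: 'x itself) \<rho> I le f \<longleftrightarrow> directed_index I le \<and>
     (\<forall>i\<in>I. integrable \<rho> (f i) \<and> (\<forall>g. 0 \<le> f i g) \<and> (\<integral>g. f i g \<partial>\<rho>) \<noteq> 0 \<and>
        (\<forall>F :: 'g \<Rightarrow> 'x. F \<in> borel_measurable borel \<longrightarrow> bounded (range F) \<longrightarrow>
           banach_integrable \<rho> (\<lambda>g. f i g *\<^sub>R F g)))"

definition right_averaging_net :: "'x::banach itself \<Rightarrow> 'g::topological_semigroup_mult measure \<Rightarrow>
    'i set \<Rightarrow> ('i \<Rightarrow> 'i \<Rightarrow> bool) \<Rightarrow> ('i \<Rightarrow> 'g \<Rightarrow> real) \<Rightarrow> bool" where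
  "right_averaging_net (X :: 'x itself) \<rho> I le f \<longleftrightarrow> integrable_net X \<rho> I le f \<and>
     (\<forall>F :: 'g \<Rightarrow> 'x. F \<in> borel_measurable borel \<longrightarrow> bounded (range F) \<longrightarrow>
        (\<forall>h. ((\<lambda>i. banach_integral \<rho> (\<lambda>g. f i g *\<^sub>R (F g - F (g * h))) /\<^sub>R (\<integral>g. f i g \<partial>\<rho>))
              \<longlongrightarrow> 0) (net_filter I le)))"

definition left_averaging_net :: "'x::banach itself \<Rightarrow> 'g::topological_semigroup_mult measure \<Rightarrow>
    'i set \<Rightarrow> ('i \<Rightarrow> 'i \<Rightarrow> bool) \<Rightarrow> ('i \<Rightarrow> 'g \<Rightarrow> real) \<Rightarrow> bool" where
  "left_averaging_net (X :: 'x itself) \<rho> I le f \<longleftrightarrow> integrable_net X \<rho> I le f \<and>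
     (\<forall>F :: 'g \<Rightarrow> 'x. F \<in> borel_measurable borel \<longrightarrow> bounded (range F) \<longrightarrow>
        (\<forall>h. ((\<lambda>i. banach_integral \<rho> (\<lambda>g. f i g *\<^sub>R (F g - F (h * g))) /\<^sub>R (\<integral>g. f i g \<partial>\<rho>))
              \<longlongrightarrow> 0) (net_filter I le)))"


section \<open>C*-dynamical systems\<close>

definition cstar_dynamical_system ::
    "('g::semigroup_mult \<Rightarrow> 'a::unital_cstar_algebra \<Rightarrow> 'a) \<Rightarrow> bool" where
  "cstar_dynamical_system \<alpha> \<longleftrightarrow>
     (\<forall>g. completely_positive (\<alpha> g) \<and> \<alpha> g 1 = 1) \<and> (\<forall>g h. \<alpha> (g * h) = \<alpha> g \<circ> \<alpha> h)"

text \<open>The type argument \<open>'i\<close> supplies the type from which the index set of the averaging net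
  is drawn.\<close>

definition amenable_system :: "'i itself \<Rightarrow> 'g::topological_semigroup_mult measure \<Rightarrow>
    ('g \<Rightarrow> 'a::unital_cstar_algebra \<Rightarrow> 'a) \<Rightarrow> bool" where
  "amenable_system (_ :: 'i itself) \<rho> \<alpha> \<longleftrightarrow>
     cstar_dynamical_system \<alpha> \<and> right_invariant_measure \<rho> \<and>
     (\<exists>(I :: 'i set) le f. right_averaging_net TYPE('a) \<rho> I le f) \<and>
     (\<forall>a. (\<lambda>g. \<alpha> g a) \<in> borel_measurable borel)"

definition fixed_system :: "('g \<Rightarrow> 'a \<Rightarrow> 'a) \<Rightarrow> 'a set" where
  "fixed_system \<alpha> = {a. \<forall>g. \<alpha> g a = a}"

definition coboundaries :: "('g \<Rightarrow> 'a::minus \<Rightarrow> 'a) \<Rightarrow> 'a set" where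
  "coboundaries \<alpha> = {a - \<alpha> g a | g a. True}"

definition right_invariant_map :: "('g \<Rightarrow> 'a \<Rightarrow> 'a) \<Rightarrow> ('a \<Rightarrow> 'b) \<Rightarrow> bool" where
  "right_invariant_map \<alpha> T \<longleftrightarrow> (\<forall>g. T \<circ> \<alpha> g = T)"

definition uniquely_ergodic_rel_fixed :: "('g \<Rightarrow> 'a::unital_cstar_algebra \<Rightarrow> 'a) \<Rightarrow> bool" where
  "uniquely_ergodic_rel_fixed \<alpha> \<longleftrightarrow>
     (\<forall>\<mu>. state_on (fixed_system \<alpha>) \<mu> \<longrightarrow>
        (\<exists>!\<nu>. state_on UNIV \<nu> \<and> right_invariant_map \<alpha> \<nu> \<and> (\<forall>b\<in>fixed_system \<alpha>. \<nu> b = \<mu> b)))"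

definition net_average :: "'g measure \<Rightarrow> ('i \<Rightarrow> 'g \<Rightarrow> real) \<Rightarrow>
    ('g \<Rightarrow> 'a::unital_cstar_algebra \<Rightarrow> 'a) \<Rightarrow> 'a \<Rightarrow> 'i \<Rightarrow> 'a" where
  "net_average \<rho> f \<alpha> a i = banach_integral \<rho> (\<lambda>g. f i g *\<^sub>R \<alpha> g a) /\<^sub>R (\<integral>g. f i g \<partial>\<rho>)"

definition averages_converge :: "'g measure \<Rightarrow> 'i set \<Rightarrow> ('i \<Rightarrow> 'i \<Rightarrow> bool) \<Rightarrow>
    ('i \<Rightarrow> 'g \<Rightarrow> real) \<Rightarrow> ('g \<Rightarrow> 'a::unital_cstar_algebra \<Rightarrow> 'a) \<Rightarrow> bool" where
  "averages_converge \<rho> I le f \<alpha> \<longleftrightarrow> (\<forall>a. \<exists>l. (net_average \<rho> f \<alpha> a \<longlongrightarrow> l) (net_filter I le))"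

definition dense_decomposition :: "('g \<Rightarrow> 'a::unital_cstar_algebra \<Rightarrow> 'a) \<Rightarrow> bool" where
  "dense_decomposition \<alpha> \<longleftrightarrow>
     closure {x + y | x y. x \<in> fixed_system \<alpha> \<and> y \<in> cspan (coboundaries \<alpha>)} = UNIV"

definition closed_decomposition :: "('g \<Rightarrow> 'a::unital_cstar_algebra \<Rightarrow> 'a) \<Rightarrow> bool" where
  "closed_decomposition \<alpha> \<longleftrightarrow>
     {x + y | x y. x \<in> fixed_system \<alpha> \<and> y \<in> closure (cspan (coboundaries \<alpha>))} = UNIV"

definition unique_norm_preserving_extension :: "('g \<Rightarrow> 'a::unital_cstar_algebra \<Rightarrow> 'a) \<Rightarrow> bool" where
  "unique_norm_preserving_extension \<alpha> \<longleftrightarrow>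
     (\<forall>\<omega>. bounded_functional_on (fixed_system \<alpha>) \<omega> \<longrightarrow>
        (\<exists>!\<eta>. bounded_functional_on UNIV \<eta> \<and> right_invariant_map \<alpha> \<eta> \<and>
           (\<forall>b\<in>fixed_system \<alpha>. \<eta> b = \<omega> b) \<and>
           functional_norm_on UNIV \<eta> = functional_norm_on (fixed_system \<alpha>) \<omega>))"

definition weak_average_projection :: "'g measure \<Rightarrow> 'i set \<Rightarrow> ('i \<Rightarrow> 'i \<Rightarrow> bool) \<Rightarrow>
    ('i \<Rightarrow> 'g \<Rightarrow> real) \<Rightarrow> ('g \<Rightarrow> 'a::unital_cstar_algebra \<Rightarrow> 'a) \<Rightarrow> 'a set \<Rightarrow> ('a \<Rightarrow> 'a) \<Rightarrow> bool" where
  "weak_average_projection \<rho> I le f \<alpha> B E \<longleftrightarrow>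
     operator_system B \<and> positive_projection_onto B E \<and>
     (\<forall>a \<phi>. state_on UNIV \<phi> \<longrightarrow>
        ((\<lambda>i. (\<integral>g. f i g *\<^sub>R \<phi> (\<alpha> g a) \<partial>\<rho>) /\<^sub>R (\<integral>g. f i g \<partial>\<rho>)) \<longlongrightarrow> \<phi> (E a))
          (net_filter I le))"

definition invariant_projection :: "('g \<Rightarrow> 'a::unital_cstar_algebra \<Rightarrow> 'a) \<Rightarrow> ('a \<Rightarrow> 'a) \<Rightarrow> bool" where
  "invariant_projection \<alpha> E \<longleftrightarrow>
     positive_projection_onto (fixed_system \<alpha>) E \<and> right_invariant_map \<alpha> E"

end

theory Submission
  imports Defs
begin

text \<open>Each average is a contraction that fixes the fixed points and, by invariance of the net,
  asymptotically absorbs the action on both sides. Hence norm convergence of the averages on a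
  dense set spreads to all of \<open>A\<close>, the limit is an invariant positive projection onto the fixed
  points, and by Hahn--Banach its kernel is the closed span of the coboundaries. Conversely, if the
  fixed points and the coboundaries do not span a dense subspace, some nonzero hermitian functional
  annihilates them. It is invariant, so it is a difference of two invariant positive functionals,
  which agree on the fixed points: unique ergodicity fails. Norm-preserving extensions of a state
  are states because they attain their norm at the unit.

  Positivity in a C*-algebra is handled without spectral theory: square roots come from the
  iteration $y \mapsto (x + y^2)/2$, and $a + i b$ is unitary for commuting self-adjoint $a$, $b$
  with $a^2 + b^2 = 1$.\<close>

section \<open>Order structure of C*-algebras\<close>

text \<open>The orbits take values in a possibly non-separable space, where sums of measurable
  functions may fail to be measurable. Identities between averages are therefore tested on bounded
  real functionals, which turn \<open>banach_integral\<close> into scalar Bochner integrals and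
  separate points by Hahn--Banach. The two conditions on the net act on different sides of the limit
  map E: the right one kills averages of coboundaries and gives
  \<open>E \<circ> \<alpha> g = E\<close>, the left one moves every limit into the fixed points and
  gives \<open>\<alpha> g \<circ> E = E\<close>. The obstacle in the proof of density is that a
  positive majorant of an invariant functional has no reason to be invariant itself. Functionals are
  found over the reals and made complex afterwards. For this passage to produce states they have to
  be hermitian, which is why \<open>re_part\<close> is built into the functionals that dominate
  them.\<close>

lemma scaleC_one [simp]: "1 *\<^sub>C (a::'a::unital_cstar_algebra) = a"
  using scaleR_scaleC[of 1 a] by simp

lemma scaleC_minus_left: "(- c) *\<^sub>C (a::'a::unital_cstar_algebra) = - (c *\<^sub>C a)"
  by (rule complex_vector.scale_minus_left)

lemma scaleC_minus_right: "c *\<^sub>C (- a::'a::unital_cstar_algebra) = - (c *\<^sub>C a)"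
  by (rule complex_vector.scale_minus_right)

lemma scaleC_diff_right: "c *\<^sub>C (a - b::'a::unital_cstar_algebra) = c *\<^sub>C a - c *\<^sub>C b"
  by (rule complex_vector.scale_right_diff_distrib)

lemma scaleC_scaleR_commute: "c *\<^sub>C (r *\<^sub>R (a::'a::unital_cstar_algebra)) = r *\<^sub>R (c *\<^sub>C a)"
  by (simp add: scaleR_scaleC scaleC_scaleC mult.commute)

lemma bounded_linear_scaleC: "bounded_linear (\<lambda>a::'a::unital_cstar_algebra. c *\<^sub>C a)"
proof (rule bounded_linear_intro[where K = "cmod c"])
  show "norm (c *\<^sub>C x) \<le> norm x * cmod c" for x :: 'a
    by (simp add: norm_scaleC mult.commute)
qed (simp_all add: scaleC_add_right scaleC_scaleR_commute)

lemma imaginary_scaleC_twice [simp]: "\<i> *\<^sub>C (\<i> *\<^sub>C (a::'a::unital_cstar_algebra)) = - a"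
  by (simp add: scaleC_scaleC scaleC_minus_left)

lemma star_one [simp]: "star (1::'a::unital_cstar_algebra) = 1"
  by (metis mult.left_neutral mult.right_neutral star_mult star_star)

lemma star_scaleR: "star (r *\<^sub>R (a::'a::unital_cstar_algebra)) = r *\<^sub>R star a"
  by (simp add: scaleR_scaleC star_scaleC)

lemma star_zero [simp]: "star (0::'a::unital_cstar_algebra) = 0"
  using star_scaleR[of 0 "0::'a"] by simp

lemma star_minus: "star (- a::'a::unital_cstar_algebra) = - star a"
  using star_scaleR[of "-1" a] by simp

lemma star_diff: "star (a - b::'a::unital_cstar_algebra) = star a - star b"
  using star_add[of a "- b"] by (simp add: star_minus)

lemma norm_star [simp]: "norm (star (a::'a::unital_cstar_algebra)) = norm a"
proof -
  have le: "norm b \<le> norm (star b)" for b :: 'a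
  proof (cases "b = 0")
    case False
    have "norm b * norm b \<le> norm (star b) * norm b"
      using cstar_identity[of b] norm_mult_ineq[of "star b" b] by (simp add: power2_eq_square)
    then show ?thesis using False by simp
  qed simp
  show ?thesis using le[of a] le[of "star a"] by (simp add: star_star)
qed

lemma bounded_linear_star: "bounded_linear (star :: 'a::unital_cstar_algebra \<Rightarrow> 'a)"
  by (rule bounded_linear_intro[where K = 1]) (simp_all add: star_add star_scaleR)

lemma norm_selfadjoint_square:
  "star a = (a::'a::unital_cstar_algebra) \<Longrightarrow> norm (a * a) = (norm a)\<^sup>2"
  using cstar_identity[of a] by simp

section \<open>Self-adjoint parts and the positive cone\<close>

definition re_part :: "'a::unital_cstar_algebra \<Rightarrow> 'a" where
  "re_part a = (1/2) *\<^sub>R (a + star a)"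

text \<open>Reusing \<open>re_part\<close> makes self-adjointness and the norm bound immediate:
  multiplication by -i is isometric and carries the imaginary part to the real one.\<close>

definition im_part :: "'a::unital_cstar_algebra \<Rightarrow> 'a" where
  "im_part a = re_part (- (\<i> *\<^sub>C a))"

lemma star_re_part [simp]: "star (re_part a) = re_part a"
  by (simp add: re_part_def star_scaleR star_add star_star add.commute)

lemma star_im_part [simp]: "star (im_part a) = im_part a"
  by (simp add: im_part_def)

lemma re_part_selfadjoint: "star a = a \<Longrightarrow> re_part a = a"
  by (simp add: re_part_def flip: scaleR_2)

lemma norm_re_part_le: "norm (re_part a) \<le> norm a"
  using norm_triangle_ineq[of a "star a"] by (simp add: re_part_def)

lemma norm_im_part_le: "norm (im_part a) \<le> norm a"
  using norm_re_part_le[of "- (\<i> *\<^sub>C a)"] by (simp add: im_part_def norm_scaleC)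

lemma re_part_add: "re_part (a + b) = re_part a + re_part b"
  by (simp add: re_part_def star_add scaleR_add_right)

lemma re_part_scaleR: "re_part (r *\<^sub>R a) = r *\<^sub>R re_part a"
  by (simp add: re_part_def star_scaleR scaleR_add_right)

lemma re_part_minus: "re_part (- b) = - re_part b"
  using re_part_scaleR[of "-1" b] by simp

lemma re_im_decomposition: "a = re_part a + \<i> *\<^sub>C im_part a"
proof -
  have "\<i> *\<^sub>C im_part a = (1/2) *\<^sub>R (a - star a)"
    by (simp add: im_part_def re_part_def scaleC_scaleR_commute scaleC_add_right scaleC_diff_right
        star_minus star_scaleC scaleC_minus_left scaleC_minus_right)
  then have "re_part a + \<i> *\<^sub>C im_part a = (1/2) *\<^sub>R (a + a)"
    by (simp add: re_part_def flip: scaleR_add_right)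
  then show ?thesis by (simp flip: scaleR_2)
qed

text \<open>The Kelley--Vaught description of positivity by norms makes the cone visibly convex.\<close>

definition pos_cone :: "'a::unital_cstar_algebra set" where
  "pos_cone = {a. star a = a \<and> (\<exists>s. norm (s *\<^sub>R 1 - a) \<le> s)}"

lemma coneI: "star a = a \<Longrightarrow> norm (s *\<^sub>R 1 - a) \<le> s \<Longrightarrow> a \<in> pos_cone"
  unfolding pos_cone_def by blast

lemma cone_selfadjoint: "a \<in> pos_cone \<Longrightarrow> star a = a"
  by (simp add: pos_cone_def)

lemma cone_add:
  assumes "a \<in> pos_cone" "b \<in> pos_cone"
  shows "a + b \<in> pos_cone"
proof -
  obtain s t where "norm (s *\<^sub>R 1 - a) \<le> s" "norm (t *\<^sub>R 1 - b) \<le> t"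
    using assms by (auto simp: pos_cone_def)
  then have "norm ((s + t) *\<^sub>R 1 - (a + b)) \<le> s + t"
    using norm_triangle_ineq[of "s *\<^sub>R 1 - a" "t *\<^sub>R 1 - b"] by (simp add: algebra_simps)
  then show ?thesis using assms by (intro coneI) (auto simp: star_add cone_selfadjoint)
qed

lemma cone_scaleR:
  assumes "a \<in> pos_cone" "r \<ge> 0"
  shows "r *\<^sub>R a \<in> pos_cone"
proof -
  obtain s where "norm (s *\<^sub>R 1 - a) \<le> s" using assms by (auto simp: pos_cone_def)
  then have "r * norm (s *\<^sub>R 1 - a) \<le> r * s" using assms(2) by (rule mult_left_mono)
  moreover have "norm ((r * s) *\<^sub>R 1 - r *\<^sub>R a) = r * norm (s *\<^sub>R 1 - a)"
    using assms(2) norm_scaleR[of r "s *\<^sub>R 1 - a"] by (simp add: algebra_simps)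
  ultimately show ?thesis using assms
    by (intro coneI[of _ "r * s"]) (auto simp: star_scaleR cone_selfadjoint)
qed

lemma cone_one_scale: "r \<ge> 0 \<Longrightarrow> r *\<^sub>R 1 \<in> pos_cone"
  by (rule coneI[of _ r]) (simp_all add: star_scaleR)

lemma cone_zero: "0 \<in> pos_cone"
  using cone_one_scale[of 0] by simp

lemma norm_bound_minus_in_cone: "star a = a \<Longrightarrow> norm a \<le> s \<Longrightarrow> s *\<^sub>R 1 - a \<in> pos_cone"
  by (rule coneI[of _ s]) (simp_all add: star_scaleR star_diff)

text \<open>The equation 2 y = x + y^2 says (1 - y)^2 = 1 - x, so y stands for 1 minus the square
  root of 1 - x. At norm 1 the recursion need not be a contraction; convergence comes from
  domination by the same recursion with the number 1 in place of x, whose increments telescope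
  inside [0,1].\<close>

lemma square_root_iteration:
  fixes x :: "'a::unital_cstar_algebra"
  assumes x: "star x = x" "norm x \<le> 1"
  obtains y where "star y = y" "norm y \<le> 1" "(1 - y) * (1 - y) = 1 - x"
    "\<And>b. x * b = b * x \<Longrightarrow> y * b = b * y"
proof -
  define t :: "nat \<Rightarrow> real" where "t = rec_nat 0 (\<lambda>_ u. (1 + u * u) / 2)"
  define Y :: "nat \<Rightarrow> 'a" where "Y = rec_nat 0 (\<lambda>_ u. (1/2) *\<^sub>R (x + u * u))"
  have t: "t 0 = 0" "\<And>n. t (Suc n) = (1 + t n * t n) / 2" by (simp_all add: t_def)
  have Y: "Y 0 = 0" "\<And>n. Y (Suc n) = (1/2) *\<^sub>R (x + Y n * Y n)" by (simp_all add: Y_def)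
  have t01: "0 \<le> t n \<and> t n \<le> 1" for n
  proof (induction n)
    case (Suc n)
    then have "t n * t n \<le> 1 * 1" by (intro mult_mono) auto
    with Suc show ?case by (simp add: t)
  qed (simp add: t)
  have Yt: "norm (Y n) \<le> t n" for n
  proof (induction n)
    case (Suc n)
    have "norm (Y n * Y n) \<le> norm (Y n) * norm (Y n)" by (rule norm_mult_ineq)
    also have "\<dots> \<le> t n * t n" using Suc t01 by (intro mult_mono) auto
    finally have "norm (x + Y n * Y n) \<le> 1 + t n * t n"
      using norm_triangle_ineq[of x "Y n * Y n"] x by linarith
    then show ?case by (simp add: Y t)
  qed (simp add: Y t)
  have commY: "Y n * b = b * Y n" if "x * b = b * x" for n b
  proof (induction n)
    case (Suc n)
    have "Y n * Y n * b = b * (Y n * Y n)" by (metis Suc mult.assoc)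
    then show ?case using that by (simp add: Y distrib_left distrib_right)
  qed (simp add: Y)
  have starY: "star (Y n) = Y n" for n
    by (induction n) (simp_all add: Y x star_scaleR star_add star_mult)
  \<comment> \<open>\<open>commY\<close> is applied twice: x commutes with itself, hence with every
    iterate, hence every iterate commutes with every other one.\<close>
  have YY: "Y m * Y n = Y n * Y m" for m n
    by (intro commY) (metis commY)
  have diff: "norm (Y (Suc n) - Y n) \<le> t (Suc n) - t n" for n
  proof (induction n)
    case 0 then show ?case using x by (simp add: Y t)
  next
    case (Suc n)
    \<comment> \<open>Difference of squares, factored with the help of \<open>YY\<close>. The scalar
      sequence satisfies the same identity, so the bound is inherited.\<close>
    have "Y (Suc (Suc n)) - Y (Suc n) = (1/2) *\<^sub>R ((Y (Suc n) - Y n) * (Y (Suc n) + Y n))"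
      unfolding Y(2)[of "Suc n"] using YY[of "Suc n" n]
      by (subst (3) Y(2)) (simp add: algebra_simps)
    then have "norm (Y (Suc (Suc n)) - Y (Suc n)) \<le>
        (1/2) * (norm (Y (Suc n) - Y n) * norm (Y (Suc n) + Y n))"
      by (simp add: norm_mult_ineq)
    also have "\<dots> \<le> (1/2) * ((t (Suc n) - t n) * (t (Suc n) + t n))"
    proof -
      have "norm (Y (Suc n) + Y n) \<le> t (Suc n) + t n"
        using norm_triangle_ineq[of "Y (Suc n)" "Y n"] Yt[of n] Yt[of "Suc n"] by linarith
      then have "norm (Y (Suc n) - Y n) * norm (Y (Suc n) + Y n) \<le>
          (t (Suc n) - t n) * (t (Suc n) + t n)"
        using Suc order_trans[OF norm_ge_zero Suc] by (intro mult_mono) auto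
      then show ?thesis by simp
    qed
    also have "\<dots> = t (Suc (Suc n)) - t (Suc n)"
      unfolding t(2)[of "Suc n"] by (subst (4) t(2)) (simp add: algebra_simps)
    finally show ?case .
  qed
  have "summable (\<lambda>n. t (Suc n) - t n)"
  proof (rule bounded_imp_summable[where B = 1])
    show "0 \<le> t (Suc n) - t n" for n using order_trans[OF norm_ge_zero diff[of n]] .
    show "(\<Sum>k\<le>n. t (Suc k) - t k) \<le> 1" for n
      using sum_lessThan_telescope[of t "Suc n"] t01[of "Suc n"] by (simp add: lessThan_Suc_atMost t)
  qed
  then have "summable (\<lambda>n. Y (Suc n) - Y n)"
    by (rule summable_comparison_test') (use diff in auto)
  then have "convergent (\<lambda>n. \<Sum>k<n. Y (Suc k) - Y k)"
    by (simp add: summable_iff_convergent)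
  then have "convergent Y" by (simp only: sum_lessThan_telescope Y(1) diff_zero)
  then obtain y where lim: "Y \<longlonglongrightarrow> y" by (auto simp: convergent_def)
  have "(\<lambda>n. Y (Suc n)) \<longlonglongrightarrow> (1/2) *\<^sub>R (x + y * y)"
    unfolding Y by (intro tendsto_intros lim)
  then have y: "y = (1/2) *\<^sub>R (x + y * y)"
    using LIMSEQ_unique LIMSEQ_Suc[OF lim] by blast
  show thesis
  proof (rule that)
    have "(\<lambda>n. star (Y n)) \<longlonglongrightarrow> star y"
      by (rule bounded_linear.tendsto[OF bounded_linear_star lim])
    then show "star y = y" using lim LIMSEQ_unique by (simp add: starY) blast
    show "norm y \<le> 1"
      by (rule LIMSEQ_le_const2[OF tendsto_norm[OF lim]]) (use Yt t01 order_trans in blast)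
    have "2 *\<^sub>R y = x + y * y" by (subst y) simp
    then show "(1 - y) * (1 - y) = 1 - x"
      by (simp add: algebra_simps scaleR_2)
    show "y * b = b * y" if "x * b = b * x" for b
    proof (rule LIMSEQ_unique)
      show "(\<lambda>n. Y n * b) \<longlonglongrightarrow> y * b" by (intro tendsto_intros lim)
      show "(\<lambda>n. Y n * b) \<longlonglongrightarrow> b * y" unfolding commY[OF that] by (intro tendsto_intros lim)
    qed
  qed
qed

text \<open>Membership in \<open>pos_cone\<close> with a constant s > 0 means that 1 - a/s has norm
  at most 1, which is what the iteration asks for. The commutation clause replaces the fact that the
  root lies in the closed algebra generated by a and 1.\<close>

lemma cone_square_root:
  assumes "a \<in> pos_cone"
  obtains r where "r \<in> pos_cone" "r * r = a" "\<And>b. a * b = b * a \<Longrightarrow> r * b = b * r"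
proof -
  obtain s where s: "norm (s *\<^sub>R 1 - a) \<le> s" using assms by (auto simp: pos_cone_def)
  then have "s \<ge> 0" using norm_ge_zero order_trans by blast
  show thesis
  proof (cases "s = 0")
    case True
    then show thesis using s that[of 0] cone_zero by simp
  next
    case False
    with \<open>s \<ge> 0\<close> have "s > 0" by simp
    define x where "x = 1 - (1/s) *\<^sub>R a"
    have ax: "a = s *\<^sub>R (1 - x)" using \<open>s > 0\<close> by (simp add: x_def)
    have "norm (s *\<^sub>R x) \<le> s" using s \<open>s > 0\<close> by (simp add: x_def algebra_simps)
    then have "norm x \<le> 1" using \<open>s > 0\<close> by simp
    moreover have "star x = x" using assms by (simp add: x_def star_diff star_scaleR cone_selfadjoint)
    ultimately obtain y where y: "star y = y" "norm y \<le> 1" "(1 - y) * (1 - y) = 1 - x"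
      "\<And>b. x * b = b * x \<Longrightarrow> y * b = b * y"
      using square_root_iteration by blast
    show thesis
    proof (rule that[of "sqrt s *\<^sub>R (1 - y)"])
      have "1 - y \<in> pos_cone" using y by (intro coneI[of _ 1]) (simp_all add: star_diff)
      then show "sqrt s *\<^sub>R (1 - y) \<in> pos_cone" using \<open>s > 0\<close> by (intro cone_scaleR) auto
      show "sqrt s *\<^sub>R (1 - y) * sqrt s *\<^sub>R (1 - y) = a"
        using \<open>s > 0\<close> by (simp add: y ax)
      show "sqrt s *\<^sub>R (1 - y) * b = b * sqrt s *\<^sub>R (1 - y)" if "a * b = b * a" for b
      proof -
        have "x * b = b * x" using that by (simp add: x_def algebra_simps)
        then have "y * b = b * y" by (rule y)
        then show ?thesis by (simp add: algebra_simps)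
      qed
    qed
  qed
qed

text \<open>The element b is the imaginary part of u = a + i b, and both u and its adjoint have norm
  1 by the C*-identity.\<close>

lemma norm_le_one_of_squares_sum:
  fixes a b :: "'a::unital_cstar_algebra"
  assumes "star a = a" "star b = b" "a * b = b * a" "a * a + b * b = 1"
  shows "norm b \<le> 1"
proof -
  define u where "u = a + \<i> *\<^sub>C b"
  have su: "star u = a - \<i> *\<^sub>C b"
    using assms by (simp add: u_def star_add star_scaleC scaleC_minus_left)
  have "star u * u = a * a + b * b"
    unfolding su unfolding u_def using assms(3)
    by (simp add: algebra_simps mult_scaleC_left mult_scaleC_right)
  then have "(norm u)\<^sup>2 = 1" using cstar_identity[of u] assms(4) by simp
  then have nu: "norm u = 1" using norm_ge_zero[of u] by (simp add: power2_eq_1_iff)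
  have "u - star u = 2 *\<^sub>R (\<i> *\<^sub>C b)" unfolding su unfolding u_def by (simp add: scaleR_2)
  then have "2 * norm b = norm (u - star u)" by (simp add: norm_scaleC)
  also have "\<dots> \<le> 2" using norm_triangle_ineq4[of u "star u"] nu by simp
  finally show ?thesis by simp
qed

text \<open>Stands in for reading off the spectrum of \<open>1 - a * a\<close>: its root 1 - y
  commutes with a and the two squares add up to 1, so the preceding bound controls the root and
  hence its square.\<close>

lemma norm_one_minus_square_le:
  assumes "star a = (a::'a::unital_cstar_algebra)" "norm a \<le> 1"
  shows "norm (1 - a * a) \<le> 1"
proof -
  have n: "norm (a * a) \<le> 1" using assms by (simp add: norm_selfadjoint_square power_le_one)
  have s: "star (a * a) = a * a" using assms by (simp add: star_mult)
  obtain y where y: "star y = y" "(1 - y) * (1 - y) = 1 - a * a"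
    "\<And>b. (a * a) * b = b * (a * a) \<Longrightarrow> y * b = b * y"
    using square_root_iteration[OF s n] by metis
  have ya: "y * a = a * y" by (rule y) (simp add: mult.assoc)
  have "norm (1 - y) \<le> 1"
  proof (rule norm_le_one_of_squares_sum[OF assms(1)])
    show "star (1 - y) = 1 - y" using y(1) by (simp add: star_diff)
    show "a * (1 - y) = (1 - y) * a" using ya by (simp add: left_diff_distrib right_diff_distrib)
    show "a * a + (1 - y) * (1 - y) = 1" unfolding y(2) by simp
  qed
  then show ?thesis
    using norm_selfadjoint_square[of "1 - y"] y(1,2) by (simp add: star_diff power_le_one)
qed

text \<open>The definition of \<open>pos_cone\<close> provides some constant s. Here every s above
  the norm is seen to work, by writing a/s as a square r * r with r of norm at most 1.\<close>

lemma norm_scale_minus_cone_le: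
  assumes "a \<in> pos_cone" "norm a \<le> s"
  shows "norm (s *\<^sub>R 1 - a) \<le> s"
proof (cases "s = 0")
  case False
  then have "s > 0" using assms(2) norm_ge_zero[of a] by linarith
  have "(1/s) *\<^sub>R a \<in> pos_cone" using cone_scaleR[OF assms(1)] \<open>s > 0\<close> by simp
  then obtain r where r: "r \<in> pos_cone" "r * r = (1/s) *\<^sub>R a"
    using cone_square_root by metis
  have "(norm r)\<^sup>2 = norm ((1/s) *\<^sub>R a)"
    using norm_selfadjoint_square[OF cone_selfadjoint[OF r(1)]] r(2) by simp
  also have "\<dots> \<le> 1" using assms(2) \<open>s > 0\<close> by simp
  finally have "norm r \<le> 1" using power2_le_imp_le[of "norm r" 1] by simp
  then have "norm (1 - (1/s) *\<^sub>R a) \<le> 1"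
    using norm_one_minus_square_le[OF cone_selfadjoint[OF r(1)]] r(2) by simp
  then have "norm (s *\<^sub>R (1 - (1/s) *\<^sub>R a)) \<le> s" using \<open>s > 0\<close> by simp
  then show ?thesis using \<open>s > 0\<close> by (simp add: scaleR_diff_right)
qed (use assms in auto)

lemma square_in_cone:
  assumes "star a = (a::'a::unital_cstar_algebra)"
  shows "a * a \<in> pos_cone"
proof (cases "a = 0")
  case False
  define b where "b = (1 / norm a) *\<^sub>R a"
  have "star b = b" "norm b \<le> 1" using assms False by (simp_all add: b_def star_scaleR)
  then have "b * b \<in> pos_cone"
    by (intro coneI[of _ 1]) (simp_all add: star_mult norm_one_minus_square_le)
  then have "(norm a * norm a) *\<^sub>R (b * b) \<in> pos_cone" by (rule cone_scaleR) simp
  then show ?thesis using False by (simp add: b_def)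
qed (simp add: cone_zero)

text \<open>The existential constant in \<open>pos_cone\<close> can be taken to be
  \<open>norm a\<close>, which turns membership into closed conditions.\<close>

lemma closed_cone: "closed (pos_cone :: 'a::unital_cstar_algebra set)"
proof -
  have "pos_cone = {a::'a. star a = a \<and> norm (norm a *\<^sub>R 1 - a) \<le> norm a}"
    using norm_scale_minus_cone_le by (auto simp: pos_cone_def)
  also have "closed \<dots>"
    by (intro closed_Collect_conj closed_Collect_eq closed_Collect_le continuous_intros
        bounded_linear.continuous_on[OF bounded_linear_star])
  finally show ?thesis .
qed

text \<open>For s = 1, the roots of p and 1 - p commute and their squares add up to 1. Scaling to
  this case requires a positive constant, so s = 0 is reached through the bounds s + e.\<close>

lemma norm_le_of_cone:
  assumes "p \<in> pos_cone" "s *\<^sub>R 1 - p \<in> pos_cone" "s \<ge> 0"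
  shows "norm p \<le> s"
proof -
  have one: "norm p \<le> 1" if p: "p \<in> pos_cone" "1 - p \<in> pos_cone" for p :: 'a
  proof -
    obtain y where y: "y \<in> pos_cone" "y * y = p" using cone_square_root[OF p(1)] by metis
    obtain w where w: "w \<in> pos_cone" "w * w = 1 - p" "\<And>b. (1 - p) * b = b * (1 - p) \<Longrightarrow> w * b = b * w"
      using cone_square_root[OF p(2)] by metis
    have "w * y = y * w" by (rule w) (simp add: algebra_simps flip: y(2))
    then have "norm y \<le> 1"
      using cone_selfadjoint[OF y(1)] cone_selfadjoint[OF w(1)] y(2) w(2)
      by (intro norm_le_one_of_squares_sum[of w]) simp_all
    then show ?thesis
      using norm_selfadjoint_square[OF cone_selfadjoint[OF y(1)]] y by (simp add: power_le_one)
  qed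
  have le: "norm p \<le> t" if "t > 0" "t \<ge> s" for t
  proof -
    have "(t - s) *\<^sub>R 1 + (s *\<^sub>R 1 - p) \<in> pos_cone"
      using that by (intro cone_add cone_one_scale assms(2)) simp
    then have tp: "t *\<^sub>R 1 - p \<in> pos_cone" by (simp add: algebra_simps)
    have "1 - (1/t) *\<^sub>R p = (1/t) *\<^sub>R (t *\<^sub>R 1 - p)" using that by (simp add: algebra_simps)
    then have "1 - (1/t) *\<^sub>R p \<in> pos_cone" using cone_scaleR[OF tp, of "1/t"] that by simp
    then have "norm ((1/t) *\<^sub>R p) \<le> 1"
      using one[OF cone_scaleR[OF assms(1), of "1/t"]] that by simp
    then show ?thesis using that by simp
  qed
  show ?thesis
  proof (rule field_le_epsilon)
    show "norm p \<le> s + e" if "e > 0" for e using le[of "s + e"] that assms(3) by simp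
  qed
qed

lemma cone_antisym:
  assumes "a \<in> pos_cone" "- a \<in> pos_cone"
  shows "a = 0"
  using norm_le_of_cone[of a 0] assms by simp

text \<open>Roots of commuting elements commute, and then \<open>a * b\<close> is the square of the
  self-adjoint product of the roots.\<close>

lemma cone_mult_commuting:
  assumes "a \<in> pos_cone" "b \<in> pos_cone" "a * b = b * a"
  shows "a * b \<in> pos_cone"
proof -
  obtain r where r: "r \<in> pos_cone" "r * r = a" "\<And>c. a * c = c * a \<Longrightarrow> r * c = c * r"
    using cone_square_root[OF assms(1)] by metis
  obtain q where q: "q \<in> pos_cone" "q * q = b" "\<And>c. b * c = c * b \<Longrightarrow> q * c = c * q"
    using cone_square_root[OF assms(2)] by metis
  have qr: "q * r = r * q" using r(3)[OF assms(3)] by (intro q(3)) simp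
  then have "star (r * q) = r * q" using r(1) q(1) by (simp add: star_mult cone_selfadjoint)
  then have "(r * q) * (r * q) \<in> pos_cone" by (rule square_in_cone)
  moreover have "(r * q) * (r * q) = (r * r) * (q * q)" by (metis qr mult.assoc)
  ultimately show ?thesis by (simp add: r(2) q(2))
qed

text \<open>The product of the two commuting positive elements is s^2 - b^2, which bounds the norm
  of b^2.\<close>

lemma norm_le_of_order_interval:
  assumes "s *\<^sub>R 1 - b \<in> pos_cone" "s *\<^sub>R 1 + b \<in> pos_cone" "s \<ge> 0"
  shows "norm b \<le> s"
proof -
  have "star (s *\<^sub>R 1 + b) = s *\<^sub>R 1 + b" by (rule cone_selfadjoint[OF assms(2)])
  then have b: "star b = b" by (simp add: star_add star_scaleR)
  have "(s *\<^sub>R 1 - b) * (s *\<^sub>R 1 + b) \<in> pos_cone"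
    by (rule cone_mult_commuting[OF assms(1,2)]) (simp add: algebra_simps)
  then have "(s * s) *\<^sub>R 1 - b * b \<in> pos_cone" by (simp add: algebra_simps)
  then have "norm (b * b) \<le> s * s" using norm_le_of_cone[OF square_in_cone[OF b]] by simp
  then have "(norm b)\<^sup>2 \<le> s\<^sup>2" unfolding norm_selfadjoint_square[OF b] by (simp only: power2_eq_square[of s])
  then show ?thesis using assms(3) by (rule power2_le_imp_le)
qed

text \<open>Usually settled by comparing the spectra of \<open>star y * y\<close> and
  \<open>y * star y\<close>. Here w = \<open>- (star y * y)\<close> is positive of norm r, and
  \<open>y * star y\<close> turns out positive as well. The relation
  \<open>y * d = (r *\<^sub>R 1 - y * star y) * y\<close> with d = r + w forces
  \<open>norm (d * w * d)\<close> to be at most r^3, although a spectral value r of w would make it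
  4 r^3.\<close>

lemma star_mult_negative_imp_zero:
  assumes "- (star y * y) \<in> pos_cone"
  shows "y = 0"
proof -
  define w where "w = - (star y * y)"
  define r where "r = (norm y)\<^sup>2"
  have w: "w \<in> pos_cone" using assms by (simp add: w_def)
  have nw: "norm w = r" using cstar_identity[of y] by (simp add: w_def r_def)
  define h k where "h = re_part y" and "k = im_part y"
  have y: "y = h + \<i> *\<^sub>C k" unfolding h_def k_def by (rule re_im_decomposition)
  have sy: "star y = h - \<i> *\<^sub>C k"
    unfolding y by (simp add: star_add star_scaleC h_def k_def scaleC_minus_left)
  \<comment> \<open>Adding the two products cancels the mixed terms h k and k h.\<close>
  have "star y * y + y * star y = 2 *\<^sub>R (h * h + k * k)"
    unfolding sy unfolding y
    by (simp add: algebra_simps mult_scaleC_left mult_scaleC_right scaleR_2)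
  then have "y * star y = w + 2 *\<^sub>R (h * h + k * k)" by (simp add: w_def algebra_simps)
  moreover have "2 *\<^sub>R (h * h + k * k) \<in> pos_cone"
    by (intro cone_scaleR cone_add square_in_cone) (simp_all add: h_def k_def)
  ultimately have "y * star y \<in> pos_cone" using cone_add[OF w] by simp
  moreover have "norm (y * star y) \<le> r"
    using cstar_identity[of "star y"] by (simp add: r_def star_star)
  ultimately have ns: "norm (r *\<^sub>R 1 - y * star y) \<le> r" by (rule norm_scale_minus_cone_le)
  define d where "d = r *\<^sub>R 1 + w"
  have sw: "star w = w" using w by (rule cone_selfadjoint)
  have sd: "star d = d" by (simp add: d_def star_add star_scaleR sw)
  have "y * d = (r *\<^sub>R 1 - y * star y) * y" by (simp add: d_def w_def algebra_simps)
  then have "norm (y * d) \<le> r * norm y"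
    using norm_mult_ineq[of "r *\<^sub>R 1 - y * star y" y] mult_right_mono[OF ns norm_ge_zero[of y]]
    by simp
  then have "(norm (y * d))\<^sup>2 \<le> (r * norm y)\<^sup>2" by (intro power_mono) auto
  moreover have "star (y * d) * (y * d) = - (d * w * d)"
    by (simp add: star_mult sd w_def mult.assoc)
  ultimately have dwd: "norm (d * w * d) \<le> r ^ 3"
    using cstar_identity[of "y * d"] by (simp add: r_def power_mult_distrib power2_eq_square power3_eq_cube)
  have wr: "w * w * w \<in> pos_cone"
    by (intro cone_mult_commuting square_in_cone) (simp_all add: w sw mult.assoc)
  have dwd_eq: "d * w * d = r\<^sup>2 *\<^sub>R w + (2 * r) *\<^sub>R (w * w) + w * w * w"
    by (simp add: d_def algebra_simps power2_eq_square flip: scaleR_2)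
  have "r ^ 3 *\<^sub>R 1 - d * w * d \<in> pos_cone"
    by (rule norm_bound_minus_in_cone[OF _ dwd]) (simp add: star_mult sd sw mult.assoc)
  \<comment> \<open>This square replaces w^2 by its tangent at r. Adding it, together with w^3,
    cancels all higher powers of w and leaves 3 r^3 - 5 r^2 w; as 3 < 5, this can only be positive
    for an element w of norm r if r = 0.\<close>
  moreover have "(2 * r) *\<^sub>R ((w - r *\<^sub>R 1) * (w - r *\<^sub>R 1)) \<in> pos_cone"
    by (intro cone_scaleR square_in_cone) (simp_all add: star_diff star_scaleR sw r_def)
  ultimately have "(r ^ 3 *\<^sub>R 1 - d * w * d) + w * w * w
      + (2 * r) *\<^sub>R ((w - r *\<^sub>R 1) * (w - r *\<^sub>R 1)) \<in> pos_cone"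
    using cone_add wr by blast
  moreover have "(r ^ 3 *\<^sub>R 1 - d * w * d) + w * w * w
      + (2 * r) *\<^sub>R ((w - r *\<^sub>R 1) * (w - r *\<^sub>R 1)) = (3 * r ^ 3) *\<^sub>R 1 - (5 * r\<^sup>2) *\<^sub>R w"
  proof -
    have e: "(w - r *\<^sub>R 1) * (w - r *\<^sub>R 1) = w * w - (2 * r) *\<^sub>R w + r\<^sup>2 *\<^sub>R 1"
      by (simp add: algebra_simps power2_eq_square flip: scaleR_2)
    have c: "3 * r ^ 3 = r ^ 3 + (2 * r) * r\<^sup>2" "5 * r\<^sup>2 = r\<^sup>2 + (2 * r) * (2 * r)"
      by (simp_all add: power2_eq_square power3_eq_cube)
    show ?thesis unfolding dwd_eq e c by (simp add: algebra_simps)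
  qed
  ultimately have "(3 * r ^ 3) *\<^sub>R 1 - (5 * r\<^sup>2) *\<^sub>R w \<in> pos_cone" by simp
  moreover have "(5 * r\<^sup>2) *\<^sub>R w \<in> pos_cone" by (intro cone_scaleR w) simp
  moreover have "0 \<le> 3 * r ^ 3" by (simp add: r_def)
  ultimately have "norm ((5 * r\<^sup>2) *\<^sub>R w) \<le> 3 * r ^ 3" by (intro norm_le_of_cone)
  then have "5 * r ^ 3 \<le> 3 * r ^ 3" by (simp add: nw power2_eq_square power3_eq_cube)
  then have "r ^ 3 \<le> 0" by simp
  moreover have "r \<ge> 0" by (simp add: r_def)
  ultimately have "r = 0" by (metis antisym zero_le_power power_eq_0_iff)
  then show ?thesis by (simp add: r_def)
qed

text \<open>With m the root of a^2 and q = m - a, the element \<open>star (x * q) * (x * q)\<close>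
  equals q a q = - m q^2 and is negative, so x q = 0 by the preceding lemma. This makes the
  self-adjoint element q nilpotent, hence zero, and a coincides with m.\<close>

lemma star_mult_in_cone: "star x * x \<in> (pos_cone :: 'a::unital_cstar_algebra set)"
proof -
  define a where "a = star x * x"
  have sa: "star a = a" by (simp add: a_def star_mult star_star)
  obtain m where m: "m \<in> pos_cone" "m * m = a * a" "\<And>b. (a * a) * b = b * (a * a) \<Longrightarrow> m * b = b * m"
    using cone_square_root[OF square_in_cone[OF sa]] by metis
  have ma: "m * a = a * m" by (rule m) (simp add: mult.assoc)
  \<comment> \<open>In the functional calculus \<open>q\<close> is twice the negative part of \<open>a\<close>.\<close>
  define q where "q = m - a"
  have sq: "star q = q" by (simp add: q_def star_diff sa m(1) cone_selfadjoint)
  have aq: "a * q = - (m * q)" by (simp add: q_def right_diff_distrib m(2) ma)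
  have qa: "q * a = - (m * q)"
    by (simp add: q_def left_diff_distrib right_diff_distrib m(2) ma)
  have mq: "m * q = q * m"
    by (simp add: q_def left_diff_distrib right_diff_distrib ma)
  have pos: "m * (q * q) \<in> pos_cone"
    by (rule cone_mult_commuting[OF m(1) square_in_cone[OF sq]]) (metis mq mult.assoc)
  have "star (x * q) * (x * q) = q * a * q" by (simp add: a_def star_mult sq mult.assoc)
  also have "\<dots> = - (m * (q * q))" by (simp add: qa mult.assoc)
  finally have e: "star (x * q) * (x * q) = - (m * (q * q))" .
  with pos have "x * q = 0" by (intro star_mult_negative_imp_zero) simp
  with e have z: "m * (q * q) = 0" by simp
  have "q * (q * q) = (m - a) * (q * q)" by (simp only: q_def)
  also have "\<dots> = m * (q * q) - a * q * q" by (simp add: left_diff_distrib mult.assoc)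
  also have "\<dots> = 0" by (simp add: aq z mult.assoc)
  finally have "(q * q) * (q * q) = 0" by (simp add: mult.assoc)
  then have "norm (q * q) = 0"
    using norm_selfadjoint_square[of "q * q"] by (simp add: star_mult sq)
  then have "q = 0" using norm_selfadjoint_square[OF sq] by simp
  then show ?thesis using m(1) by (simp add: q_def a_def)
qed

lemma cstar_positive_iff_cone: "cstar_positive a \<longleftrightarrow> a \<in> pos_cone"
proof
  show "cstar_positive a \<Longrightarrow> a \<in> pos_cone" unfolding cstar_positive_def using star_mult_in_cone by blast
  assume "a \<in> pos_cone"
  then obtain r where "r \<in> pos_cone" "r * r = a" using cone_square_root by metis
  then show "cstar_positive a" unfolding cstar_positive_def using cone_selfadjoint by metis
qed

section \<open>Positive and completely positive maps\<close>

lemma clinear_on_simps: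
  assumes "clinear_on UNIV T"
  shows "T (a + b) = T a + T b" "T (c *\<^sub>C a) = c *\<^sub>C T a" "T (r *\<^sub>R a) = r *\<^sub>R T a"
    "T 0 = 0" "T (- a) = - T a" "T (a - b) = T a - T b"
proof -
  show add: "T (a + b) = T a + T b" for a b using assms by (simp add: clinear_on_def)
  show sc: "T (c *\<^sub>C a) = c *\<^sub>C T a" for c a using assms by (simp add: clinear_on_def)
  show r: "T (r *\<^sub>R a) = r *\<^sub>R T a" for r a unfolding scaleR_scaleC by (rule sc)
  show "T 0 = 0" using r[of 0 0] by simp
  show m: "T (- a) = - T a" for a using r[of "-1" a] by simp
  show "T (a - b) = T a - T b" using add[of a "- b"] m[of b] by simp
qed

lemma clinear_bounded_linear:
  assumes "clinear_on UNIV T" "\<And>a. norm (T a) \<le> K * norm a"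
  shows "bounded_linear T"
  by (rule bounded_linear_intro[where K = K])
    (use assms in \<open>simp_all add: clinear_on_simps[OF assms(1)] mult.commute\<close>)

lemma positive_map_selfadjoint:
  fixes T :: "'a::unital_cstar_algebra \<Rightarrow> 'b::unital_cstar_algebra"
  assumes T: "clinear_on UNIV T" "\<And>a. a \<in> pos_cone \<Longrightarrow> T a \<in> pos_cone" and a: "star a = a"
  shows "star (T a) = T a"
proof -
  \<comment> \<open>A self-adjoint a is the difference of the positive elements
    \<open>norm a *\<^sub>R 1\<close> and \<open>norm a *\<^sub>R 1 - a\<close>.\<close>
  have "star (T (norm a *\<^sub>R 1 - a)) = T (norm a *\<^sub>R 1 - a)"
    by (intro cone_selfadjoint T(2) norm_bound_minus_in_cone a) simp
  moreover have "star (T (norm a *\<^sub>R 1)) = T (norm a *\<^sub>R 1)"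
    by (intro cone_selfadjoint T(2) cone_one_scale) simp
  ultimately show ?thesis by (simp add: clinear_on_simps[OF T(1)] star_diff)
qed

lemma positive_map_star:
  fixes T :: "'a::unital_cstar_algebra \<Rightarrow> 'b::unital_cstar_algebra"
  assumes T: "clinear_on UNIV T" "\<And>a. a \<in> pos_cone \<Longrightarrow> T a \<in> pos_cone"
  shows "T (star a) = star (T a)"
proof -
  define h k where "h = re_part a" and "k = im_part a"
  have a: "a = h + \<i> *\<^sub>C k" unfolding h_def k_def by (rule re_im_decomposition)
  have hk: "star h = h" "star k = k" by (simp_all add: h_def k_def)
  have "star (T h) = T h" "star (T k) = T k" using positive_map_selfadjoint[OF T] hk by auto
  then show ?thesis
    unfolding a by (simp add: star_add star_scaleC hk clinear_on_simps[OF T(1)])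
qed

lemma positive_unital_map_norm_selfadjoint:
  fixes T :: "'a::unital_cstar_algebra \<Rightarrow> 'b::unital_cstar_algebra"
  assumes T: "clinear_on UNIV T" "\<And>a. a \<in> pos_cone \<Longrightarrow> T a \<in> pos_cone" "T 1 = 1"
    and a: "star a = a"
  shows "norm (T a) \<le> norm a"
proof (rule norm_le_of_order_interval)
  have "T (norm a *\<^sub>R 1 - b) \<in> pos_cone" if "star b = b" "norm b \<le> norm a" for b
    using that by (intro T(2) norm_bound_minus_in_cone)
  from this[of a] this[of "- a"] a
  show "norm a *\<^sub>R 1 - T a \<in> pos_cone" "norm a *\<^sub>R 1 + T a \<in> pos_cone"
    by (simp_all add: clinear_on_simps[OF T(1)] T(3) star_minus)
qed simp

text \<open>The factor 2 comes from splitting into self-adjoint parts. It is good enough for its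
  purpose, the continuity of projections that are assumed merely positive.\<close>

lemma positive_unital_map_norm_le:
  fixes T :: "'a::unital_cstar_algebra \<Rightarrow> 'b::unital_cstar_algebra"
  assumes T: "clinear_on UNIV T" "\<And>a. a \<in> pos_cone \<Longrightarrow> T a \<in> pos_cone" "T 1 = 1"
  shows "norm (T a) \<le> 2 * norm a"
proof -
  have "T a = T (re_part a) + \<i> *\<^sub>C T (im_part a)"
    using arg_cong[OF re_im_decomposition[of a], of T] by (simp add: clinear_on_simps[OF T(1)])
  then have "norm (T a) \<le> norm (T (re_part a)) + norm (T (im_part a))"
    using norm_triangle_ineq[of "T (re_part a)" "\<i> *\<^sub>C T (im_part a)"] by (simp add: norm_scaleC)
  then show ?thesis
    using positive_unital_map_norm_selfadjoint[OF T star_re_part, of a]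
      positive_unital_map_norm_selfadjoint[OF T star_im_part, of a]
      norm_re_part_le[of a] norm_im_part_le[of a] by simp
qed

lemma completely_positive_clinear: "completely_positive T \<Longrightarrow> clinear_on UNIV T"
  by (simp add: completely_positive_def)

lemma completely_positive_cone:
  assumes "completely_positive T" "a \<in> pos_cone"
  shows "T a \<in> pos_cone"
proof -
  obtain x where x: "a = star x * x"
    using assms(2) unfolding cstar_positive_iff_cone[symmetric] cstar_positive_def by blast
  have "matrix_positive 1 (\<lambda>_ _. a)"
    unfolding matrix_positive_def by (rule exI[of _ "\<lambda>_ _. x"]) (simp add: x)
  then have "matrix_positive 1 (\<lambda>_ _. T a)" using assms(1) by (simp add: completely_positive_def)
  then obtain X where "T a = star (X 0 0) * X (0::nat) (0::nat)"
    unfolding matrix_positive_def by auto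
  then show ?thesis by (simp add: star_mult_in_cone)
qed

text \<open>The Kadison--Schwarz inequality $T(x)^* T(x) \le T(x^* x)$, from positivity of the image
  of the matrix with rows $(1, x)$ and $(x^*, x^* x)$.\<close>

lemma completely_positive_norm_le:
  fixes T :: "'a::unital_cstar_algebra \<Rightarrow> 'a"
  assumes T: "completely_positive T" "T 1 = 1"
  shows "norm (T x) \<le> norm x"
proof -
  note lin = clinear_on_simps[OF completely_positive_clinear[OF T(1)]]
  \<comment> \<open>The row (1, x), padded by a zero row to the square format of
    \<open>matrix_positive\<close>.\<close>
  define X :: "nat \<Rightarrow> nat \<Rightarrow> 'a"
    where "X = (\<lambda>k i. if k = 0 then (if i = 0 then 1 else x) else 0)"
  define M where "M = (\<lambda>i j. star (X 0 i) * X 0 j)"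
  have "matrix_positive 2 M"
    unfolding matrix_positive_def
    by (rule exI[of _ X]) (auto simp: M_def X_def numeral_2_eq_2)
  then have "matrix_positive 2 (\<lambda>i j. T (M i j))" using T(1) by (simp add: completely_positive_def)
  then obtain Y where Y: "\<And>i j. i < 2 \<Longrightarrow> j < 2 \<Longrightarrow> T (M i j) = (\<Sum>k<2. star (Y k i) * Y (k::nat) j)"
    unfolding matrix_positive_def by blast
  define p0 p1 q0 q1 where pq: "p0 = Y 0 0" "p1 = Y (Suc 0) 0"
      "q0 = Y 0 (Suc 0)" "q1 = Y (Suc 0) (Suc 0)"
  define c where "c = T x"
  have S: "(\<Sum>k<2. f k) = f 0 + f (Suc 0)" for f :: "nat \<Rightarrow> 'a" by (simp add: numeral_2_eq_2)
  have e1: "star p0 * p0 + star p1 * p1 = 1"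
    using Y[of 0 0] by (simp add: S M_def X_def T(2) flip: pq)
  have e2: "star p0 * q0 + star p1 * q1 = c"
    using Y[of 0 "Suc 0"] by (simp add: S M_def X_def c_def flip: pq)
  have e3: "star q0 * q0 + star q1 * q1 = T (star x * x)"
    using Y[of "Suc 0" "Suc 0"] by (simp add: S M_def X_def flip: pq)
  have e4: "star q0 * p0 + star q1 * p1 = star c"
    by (simp flip: e2 add: star_add star_mult star_star)
  \<comment> \<open>The columns p and q of Y behave like vectors with inner square 1 for p and inner
    product c between p and q; hence the inner square of q - p c is
    \<open>T (star x * x) - star c * c\<close>.\<close>
  have "star (q0 - p0 * c) * (q0 - p0 * c) + star (q1 - p1 * c) * (q1 - p1 * c) \<in> pos_cone"
    by (intro cone_add star_mult_in_cone)
  moreover have "star (q0 - p0 * c) * (q0 - p0 * c) + star (q1 - p1 * c) * (q1 - p1 * c) =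
      (star q0 * q0 + star q1 * q1) - (star q0 * p0 + star q1 * p1) * c
      - star c * (star p0 * q0 + star p1 * q1) + star c * (star p0 * p0 + star p1 * p1) * c"
    by (simp add: star_diff star_mult algebra_simps)
  ultimately have ks: "T (star x * x) - star c * c \<in> pos_cone"
    unfolding e1 e2 e3 e4 by simp
  have "norm (star x * x) \<le> (norm x)\<^sup>2" by (simp add: cstar_identity)
  then have "(norm x)\<^sup>2 *\<^sub>R 1 - star x * x \<in> pos_cone"
    by (intro norm_bound_minus_in_cone) (simp_all add: star_mult star_star)
  then have "T ((norm x)\<^sup>2 *\<^sub>R 1 - star x * x) \<in> pos_cone" by (rule completely_positive_cone[OF T(1)])
  then have "((norm x)\<^sup>2 *\<^sub>R 1 - T (star x * x)) + (T (star x * x) - star c * c) \<in> pos_cone"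
    using ks by (intro cone_add) (simp_all add: lin T(2))
  then have "(norm x)\<^sup>2 *\<^sub>R 1 - star c * c \<in> pos_cone" by simp
  then have "norm (star c * c) \<le> (norm x)\<^sup>2" by (intro norm_le_of_cone star_mult_in_cone) simp_all
  then have "(norm c)\<^sup>2 \<le> (norm x)\<^sup>2" by (simp add: cstar_identity)
  then show ?thesis unfolding c_def by (rule power2_le_imp_le) simp
qed

section \<open>The Hahn--Banach theorem\<close>

text \<open>Homogeneity is only an inequality, the form in which it is checked for infima. Equality
  for positive factors follows by passing to the reciprocal.\<close>

definition sublinear :: "('v::real_vector \<Rightarrow> real) \<Rightarrow> bool" where
  "sublinear p \<longleftrightarrow> (\<forall>x y. p (x + y) \<le> p x + p y) \<and> (\<forall>r x. r \<ge> 0 \<longrightarrow> p (r *\<^sub>R x) \<le> r * p x)"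

lemma sublinear_add: "sublinear p \<Longrightarrow> p (x + y) \<le> p x + p y"
  by (simp add: sublinear_def)

lemma sublinear_scale: "sublinear p \<Longrightarrow> r \<ge> 0 \<Longrightarrow> p (r *\<^sub>R x) \<le> r * p x"
  by (simp add: sublinear_def)

lemma sublinear_zero: "sublinear p \<Longrightarrow> p 0 = 0"
  using sublinear_add[of p 0 0] sublinear_scale[of p 0 0] by simp

lemma sublinear_minus: "sublinear p \<Longrightarrow> - p (- x) \<le> p x"
  using sublinear_add[of p x "- x"] sublinear_zero[of p] by simp

text \<open>Every dominating functional in the sequel except the norm arises as such an infimum:
  shifted functionals, infima of chains, the distance to a subspace, and the order bounds behind
  states and invariant majorants.\<close>

lemma sublinear_Inf:
  fixes S :: "'v::real_vector \<Rightarrow> real set"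
  assumes ne: "\<And>x. S x \<noteq> {}" and bdd: "\<And>x. bdd_below (S x)"
    and add: "\<And>x y a b. a \<in> S x \<Longrightarrow> b \<in> S y \<Longrightarrow> \<exists>c\<in>S (x + y). c \<le> a + b"
    and scale: "\<And>x a r. r > 0 \<Longrightarrow> a \<in> S x \<Longrightarrow> \<exists>c\<in>S (r *\<^sub>R x). c \<le> r * a"
    and zero: "\<exists>c\<in>S 0. c \<le> 0"
  shows "sublinear (\<lambda>x. Inf (S x))"
proof -
  have le: "Inf (S x) \<le> a" if "\<exists>c\<in>S x. c \<le> a" for x a
    using that bdd cInf_lower order_trans by metis
  show ?thesis unfolding sublinear_def
  proof (intro conjI allI impI)
    fix x y
    have "Inf (S (x + y)) - b \<le> Inf (S x)" if "b \<in> S y" for b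
      by (rule cInf_greatest[OF ne]) (use le[OF add[OF _ that]] in \<open>simp add: algebra_simps\<close>)
    then have "Inf (S (x + y)) - Inf (S x) \<le> Inf (S y)"
      by (intro cInf_greatest[OF ne]) (simp add: algebra_simps)
    then show "Inf (S (x + y)) \<le> Inf (S x) + Inf (S y)" by simp
  next
    fix r :: real and x assume "r \<ge> 0"
    show "Inf (S (r *\<^sub>R x)) \<le> r * Inf (S x)"
    proof (cases "r = 0")
      case True then show ?thesis using le[OF zero] by simp
    next
      case False
      with \<open>r \<ge> 0\<close> have "r > 0" by simp
      have "Inf (S (r *\<^sub>R x)) / r \<le> Inf (S x)"
        by (rule cInf_greatest[OF ne])
          (use le[OF scale[OF \<open>r > 0\<close>]] \<open>r > 0\<close> in \<open>simp add: divide_le_eq mult.commute\<close>)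
      then show ?thesis using \<open>r > 0\<close> by (simp add: divide_le_eq mult.commute)
    qed
  qed
qed

text \<open>Take the infimum over t \<ge> 0 of p (x + t z) - t p z; the parameter t = 1 gives the
  value at -z. The device serves twice: to prescribe the value of a functional at a point, and to
  show that minimal sublinear functionals are odd.\<close>

lemma sublinear_shift:
  assumes p: "sublinear p"
  obtains q where "sublinear q" "\<And>x. q x \<le> p x" "q (- z) \<le> - p z"
proof -
  define S where "S = (\<lambda>x. {p (x + t *\<^sub>R z) - t * p z | t. t \<ge> 0})"
  have mem: "p (x + t *\<^sub>R z) - t * p z \<in> S x" if "t \<ge> 0" for x t
    using that by (auto simp: S_def)
  have bdd: "bdd_below (S x)" for x
  proof (rule bdd_belowI)
    fix a assume "a \<in> S x"
    then obtain t where t: "t \<ge> 0" "a = p (x + t *\<^sub>R z) - t * p z" by (auto simp: S_def)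
    show "- p (- x) - p (- z) * 0 \<le> a"
    proof (cases "t = 0")
      case True then show ?thesis using t sublinear_minus[OF p, of x] by simp
    next
      case False
      have "t *\<^sub>R z = (x + t *\<^sub>R z) + - x" by simp
      then have "p (t *\<^sub>R z) \<le> p (x + t *\<^sub>R z) + p (- x)" using sublinear_add[OF p] by metis
      moreover have "p ((1/t) *\<^sub>R (t *\<^sub>R z)) \<le> (1/t) * p (t *\<^sub>R z)"
        using t by (intro sublinear_scale[OF p]) simp
      then have "t * p z \<le> p (t *\<^sub>R z)" using t False by (simp add: field_simps)
      ultimately show ?thesis using t by simp
    qed
  qed
  have low: "Inf (S x) \<le> p (x + t *\<^sub>R z) - t * p z" if "t \<ge> 0" for x t
    by (rule cInf_lower[OF mem[OF that] bdd])
  show thesis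
  proof (rule that[of "\<lambda>x. Inf (S x)"])
    show "sublinear (\<lambda>x. Inf (S x))"
    proof (rule sublinear_Inf[OF _ bdd])
      show "S x \<noteq> {}" for x using mem[of 0] by blast
      show "\<exists>c\<in>S (x + y). c \<le> a + b" if ab: "a \<in> S x" "b \<in> S y" for x y a b
      proof -
        obtain s t where st: "s \<ge> 0" "t \<ge> 0" "a = p (x + s *\<^sub>R z) - s * p z"
          "b = p (y + t *\<^sub>R z) - t * p z" using ab by (auto simp: S_def)
        have "x + y + (s + t) *\<^sub>R z = (x + s *\<^sub>R z) + (y + t *\<^sub>R z)" by (simp add: algebra_simps)
        then have "p (x + y + (s + t) *\<^sub>R z) \<le> p (x + s *\<^sub>R z) + p (y + t *\<^sub>R z)"
          using sublinear_add[OF p] by metis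
        then show ?thesis using st
          by (intro bexI[OF _ mem[of "s + t"]]) (simp_all add: algebra_simps)
      qed
      show "\<exists>c\<in>S (r *\<^sub>R x). c \<le> r * a" if ra: "r > 0" "a \<in> S x" for x a r
      proof -
        obtain t where t: "t \<ge> 0" "a = p (x + t *\<^sub>R z) - t * p z" using ra by (auto simp: S_def)
        have "r *\<^sub>R x + (r * t) *\<^sub>R z = r *\<^sub>R (x + t *\<^sub>R z)" by (simp add: algebra_simps)
        then have "p (r *\<^sub>R x + (r * t) *\<^sub>R z) \<le> r * p (x + t *\<^sub>R z)"
          using sublinear_scale[OF p] ra by simp
        moreover have "r * a = r * p (x + t *\<^sub>R z) - (r * t) * p z" by (simp add: t algebra_simps)
        ultimately show ?thesis using t(1) ra(1) by (intro bexI[OF _ mem[of "r * t"]]) simp_all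
      qed
      show "\<exists>c\<in>S 0. c \<le> 0"
        by (rule bexI[OF _ mem[of 0]]) (simp_all add: sublinear_zero[OF p])
    qed
    show "Inf (S x) \<le> p x" for x using low[of 0 x] by simp
    show "Inf (S (- z)) \<le> - p z" using low[of 1 "- z"] by (simp add: sublinear_zero[OF p])
  qed
qed

text \<open>Zorn's lemma for the reversed pointwise order. The infimum of a nonempty chain is finite
  because every member lies above - p (- x), and it is subadditive because any two members have a
  common lower bound in the chain.\<close>

lemma minimal_sublinear:
  assumes p: "sublinear (p :: 'v::real_vector \<Rightarrow> real)"
  obtains m where "sublinear m" "\<And>x. m x \<le> p x" "\<And>q. sublinear q \<Longrightarrow> q \<le> m \<Longrightarrow> q = m"
proof -
  define A where "A = {q. sublinear q \<and> q \<le> p}"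
  have "\<exists>m\<in>A. \<forall>q\<in>A. q \<le> m \<longrightarrow> q = m"
  proof (rule predicate_Zorn)
    show "partial_order_on A (relation_of (\<lambda>q q'. q' \<le> q) A)"
      by (rule partial_order_on_relation_ofI) auto
    fix C assume "C \<in> Chains (relation_of (\<lambda>q q'. q' \<le> q) A)"
    then have C: "C \<subseteq> A" "\<And>q q'. q \<in> C \<Longrightarrow> q' \<in> C \<Longrightarrow> q' \<le> q \<or> q \<le> q'"
      unfolding Chains_def relation_of_def by auto
    show "\<exists>u\<in>A. \<forall>a\<in>C. u \<le> a"
    proof (cases "C = {}")
      case True then show ?thesis using p by (auto simp: A_def)
    next
      case False
      define S where "S = (\<lambda>x. (\<lambda>q. q x) ` C)"
      have bdd: "bdd_below (S x)" for x
      proof (rule bdd_belowI)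
        fix a assume "a \<in> S x"
        then obtain q where q: "q \<in> C" "a = q x" by (auto simp: S_def)
        then have "sublinear q" "q (- x) \<le> p (- x)" using C(1) by (auto simp: A_def le_fun_def)
        then show "- p (- x) \<le> a" using sublinear_minus[of q x] q(2) by simp
      qed
      have low: "Inf (S x) \<le> q x" if "q \<in> C" for q x
        by (rule cInf_lower[OF _ bdd]) (use that in \<open>auto simp: S_def\<close>)
      have sub: "sublinear q" if "q \<in> C" for q using that C(1) by (auto simp: A_def)
      have "sublinear (\<lambda>x. Inf (S x))"
      proof (rule sublinear_Inf[OF _ bdd])
        show "S x \<noteq> {}" for x using False by (simp add: S_def)
        show "\<exists>c\<in>S (x + y). c \<le> a + b" if ab: "a \<in> S x" "b \<in> S y" for x y a b
        proof -
          obtain q q' where q: "q \<in> C" "a = q x" "q' \<in> C" "b = q' y" using ab by (auto simp: S_def)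
          have "\<exists>u\<in>C. u \<le> q \<and> u \<le> q'" using C(2)[OF q(1,3)] q(1,3) by auto
          then obtain u where u: "u \<in> C" "u x \<le> q x" "u y \<le> q' y" by (auto simp: le_fun_def)
          have "u (x + y) \<le> u x + u y" by (rule sublinear_add[OF sub[OF u(1)]])
          then have "u (x + y) \<le> a + b" using q u by linarith
          then show ?thesis using u(1) by (auto simp: S_def)
        qed
        show "\<exists>c\<in>S (r *\<^sub>R x). c \<le> r * a" if ra: "r > 0" "a \<in> S x" for x a r
        proof -
          obtain q where q: "q \<in> C" "a = q x" using ra(2) by (auto simp: S_def)
          then have "q (r *\<^sub>R x) \<le> r * a" using sublinear_scale[OF sub[OF q(1)], of r x] ra(1) by simp
          then show ?thesis using q(1) by (auto simp: S_def)
        qed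
        obtain q where q: "q \<in> C" using False by auto
        then have "q 0 \<le> 0" using sublinear_zero[OF sub[OF q]] by simp
        then show "\<exists>c\<in>S 0. c \<le> 0" using q by (auto simp: S_def)
      qed
      moreover obtain q where q: "q \<in> C" using False by auto
      have "(\<lambda>x. Inf (S x)) \<le> p"
      proof (rule le_funI)
        fix x
        have "Inf (S x) \<le> q x" by (rule low[OF q])
        also have "q x \<le> p x" using q C(1) by (auto simp: A_def le_fun_def)
        finally show "Inf (S x) \<le> p x" .
      qed
      ultimately have "(\<lambda>x. Inf (S x)) \<in> A" by (simp add: A_def)
      then show ?thesis using low by (intro bexI[of _ "\<lambda>x. Inf (S x)"]) (auto simp: le_fun_def)
    qed
  qed
  then obtain m where m: "m \<in> A" "\<And>q. q \<in> A \<Longrightarrow> q \<le> m \<Longrightarrow> q = m" by blast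
  show thesis
  proof (rule that[of m])
    show "sublinear m" "m x \<le> p x" for x using m(1) by (auto simp: A_def le_fun_def)
    show "q = m" if "sublinear q" "q \<le> m" for q
    proof (rule m(2))
      show "q \<in> A" using that m(1) by (auto simp: A_def)
    qed (rule that(2))
  qed
qed

text \<open>Instead of extending from a subspace, a minimal sublinear functional m is taken.
  Shifting it at x yields nothing smaller, so m (- x) \<le> - m x, and an odd sublinear functional
  is linear. The initial shift at z forces the value there.\<close>

theorem Hahn_Banach_sublinear:
  assumes p: "sublinear p"
  obtains f where "linear f" "\<And>x. f x \<le> p x" "f z = p z"
proof -
  obtain p' where p': "sublinear p'" "\<And>x. p' x \<le> p x" "p' (- z) \<le> - p z"
    using sublinear_shift[OF p] by metis
  obtain m where m: "sublinear m" "\<And>x. m x \<le> p' x" "\<And>q. sublinear q \<Longrightarrow> q \<le> m \<Longrightarrow> q = m"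
    using minimal_sublinear[OF p'(1)] by metis
  have neg: "m (- x) = - m x" for x
  proof -
    obtain q where q: "sublinear q" "\<And>y. q y \<le> m y" "q (- x) \<le> - m x"
      using sublinear_shift[OF m(1)] by metis
    have "q = m" by (rule m(3)) (use q in \<open>auto simp: le_fun_def\<close>)
    then show ?thesis using q(3) sublinear_minus[OF m(1), of x] by simp
  qed
  have lin: "linear m"
  proof (rule linearI)
    show "m (x + y) = m x + m y" for x y
      using sublinear_add[OF m(1), of x y] sublinear_add[OF m(1), of "x + y" "- y"] neg[of y] by simp
    have pos: "m (r *\<^sub>R x) = r * m x" if "r \<ge> 0" for r x
      using sublinear_scale[OF m(1) that, of x] sublinear_scale[OF m(1) that, of "- x"]
      by (simp add: neg)
    show "m (r *\<^sub>R x) = r *\<^sub>R m x" for r x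
      using pos[of r x] pos[of "- r" x] neg[of "r *\<^sub>R x"] by (cases "r \<ge> 0") auto
  qed
  show thesis
  proof (rule that[OF lin])
    show le: "m x \<le> p x" for x using m(2) p'(2) order_trans by blast
    show "m z = p z" using m(2)[of "- z"] p'(3) neg[of z] le[of z] by simp
  qed
qed

section \<open>Functionals bounded by the norm\<close>

lemma linear_bounded_by_norm:
  fixes f :: "'v::real_normed_vector \<Rightarrow> real"
  assumes "linear f" "\<And>x. f x \<le> norm x"
  shows "\<bar>f x\<bar> \<le> norm x" "bounded_linear f"
proof -
  show b: "\<bar>f x\<bar> \<le> norm x" for x
    using assms(2)[of x] assms(2)[of "- x"] linear_neg[OF assms(1), of x] by simp
  show "bounded_linear f"
    using assms(1) b by (intro bounded_linear_intro[where K = 1]) (auto simp: linear_add linear_scale)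
qed

lemma norming_functional:
  fixes z :: "'v::real_normed_vector"
  obtains f where "bounded_linear f" "\<And>x. \<bar>f x\<bar> \<le> norm x" "f z = norm z"
proof -
  have "sublinear (norm :: 'v \<Rightarrow> real)" by (simp add: sublinear_def norm_triangle_ineq)
  then obtain f where f: "linear f" "\<And>x. f x \<le> norm x" "f z = norm z"
    using Hahn_Banach_sublinear by metis
  with linear_bounded_by_norm[OF f(1,2)] show thesis using that by blast
qed

lemma bounded_functionals_separate:
  fixes x y :: "'v::real_normed_vector"
  assumes "\<And>f :: 'v \<Rightarrow> real. bounded_linear f \<Longrightarrow> f x = f y"
  shows "x = y"
proof -
  obtain f where f: "bounded_linear f" "f (x - y) = norm (x - y)"
    using norming_functional by metis
  then have "norm (x - y) = 0"
    using assms[OF f(1)] by (simp add: linear_diff[OF bounded_linear.linear])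
  then show ?thesis by simp
qed

text \<open>The distance to W is the dominating functional: it vanishes on W, lies below the norm
  and is positive at z.\<close>

lemma annihilating_functional:
  fixes W :: "'v::real_normed_vector set"
  assumes W: "subspace W" and z: "z \<notin> closure W"
  obtains f where "bounded_linear f" "\<And>x. \<bar>f x\<bar> \<le> norm x" "\<And>x. x \<in> W \<Longrightarrow> f x = 0" "f z \<noteq> 0"
proof -
  define S where "S = (\<lambda>x. dist x ` W)"
  have ne: "W \<noteq> {}" using subspace_0[OF W] by auto
  have dist_Inf: "infdist x W = Inf (S x)" for x using ne by (simp add: infdist_def S_def)
  have "sublinear (\<lambda>x. Inf (S x))"
  proof (rule sublinear_Inf)
    show "S x \<noteq> {}" for x using ne by (simp add: S_def)
    show "bdd_below (S x)" for x by (rule bdd_belowI[of _ 0]) (auto simp: S_def)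
    show "\<exists>c\<in>S (x + y). c \<le> a + b" if ab: "a \<in> S x" "b \<in> S y" for x y a b
    proof -
      obtain u v where "u \<in> W" "v \<in> W" "a = dist x u" "b = dist y v" using ab by (auto simp: S_def)
      then show ?thesis using dist_triangle_add[of x y u v] subspace_add[OF W]
        by (intro bexI[of _ "dist (x + y) (u + v)"]) (auto simp: S_def)
    qed
    show "\<exists>c\<in>S (r *\<^sub>R x). c \<le> r * a" if ra: "r > 0" "a \<in> S x" for x a r
    proof -
      obtain u where "u \<in> W" "a = dist x u" using ra by (auto simp: S_def)
      moreover have "dist (r *\<^sub>R x) (r *\<^sub>R u) = r * dist x u"
        using ra(1) by (simp add: dist_norm flip: scaleR_diff_right)
      moreover have "dist (r *\<^sub>R x) (r *\<^sub>R u) \<in> S (r *\<^sub>R x)"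
        unfolding S_def using \<open>u \<in> W\<close> by (intro imageI subspace_scale[OF W])
      ultimately show ?thesis using \<open>a = dist x u\<close> by (metis order_refl)
    qed
    show "\<exists>c\<in>S 0. c \<le> 0" using subspace_0[OF W] by (intro bexI[of _ "dist 0 0"]) (auto simp: S_def)
  qed
  then have sub: "sublinear (\<lambda>x. infdist x W)" by (simp add: dist_Inf)
  obtain f where f: "linear f" "\<And>x. f x \<le> infdist x W" "f z = infdist z W"
    using Hahn_Banach_sublinear[OF sub] by metis
  have "f x \<le> norm x" for x
    using f(2)[of x] infdist_le[OF subspace_0[OF W], of x] by simp
  note b = linear_bounded_by_norm[OF f(1) this]
  show thesis
  proof (rule that[OF b(2,1)])
    show "f x = 0" if "x \<in> W" for x
      using f(2)[of x] f(2)[of "- x"] that subspace_neg[OF W that] linear_neg[OF f(1), of x] by simp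
    show "f z \<noteq> 0" using z f(3) in_closure_iff_infdist_zero[OF ne] by simp
  qed
qed

section \<open>Averages of the orbits\<close>

text \<open>Measurability of the composite is assumed separately, since F itself is only an almost
  everywhere limit of simple functions and may fail to be Borel measurable.\<close>

lemma has_banach_integral_bounded_linear:
  fixes T :: "'x::real_normed_vector \<Rightarrow> 'b::{banach, second_countable_topology}"
  assumes F: "has_banach_integral M F x" and T: "bounded_linear T"
    and meas: "(\<lambda>g. T (F g)) \<in> borel_measurable M"
  shows "has_bochner_integral M (\<lambda>g. T (F g)) (T x)"
proof -
  obtain K where K: "K > 0" "\<And>x. norm (T x) \<le> norm x * K"
    using bounded_linear.pos_bounded[OF T] by blast
  \<comment> \<open>Rescaling to a contraction avoids pulling a constant out of the lower integral of a
    function that need not be measurable.\<close>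
  define T' where "T' = (\<lambda>x. (1/K) *\<^sub>R T x)"
  have T': "bounded_linear T'" unfolding T'_def by (rule bounded_linear_const_scaleR[OF T])
  have norm_T': "norm (T' x) \<le> norm x" for x
    using K(1) K(2)[of x] by (simp add: T'_def divide_le_eq)
  obtain s where s: "\<And>i. Bochner_Integration.simple_bochner_integrable M (s i)"
    "(\<lambda>i. \<integral>\<^sup>+ g. norm (F g - s i g) \<partial>M) \<longlonglongrightarrow> 0"
    "(\<lambda>i. Bochner_Integration.simple_bochner_integral M (s i)) \<longlonglongrightarrow> x"
    using F unfolding has_banach_integral_def by blast
  have "has_bochner_integral M (\<lambda>g. T' (F g)) (T' x)"
  proof (rule has_bochner_integral.intros)
    show "(\<lambda>g. T' (F g)) \<in> borel_measurable M" unfolding T'_def using meas by simp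
    show "Bochner_Integration.simple_bochner_integrable M (\<lambda>g. T' (s i g))" for i
      using simple_bochner_integrable_compose2[where p = "\<lambda>x _. T' x", OF _ s(1) s(1)]
        bounded_linear.linear[OF T'] by (simp add: linear_0)
    show "(\<lambda>i. \<integral>\<^sup>+ g. norm (T' (F g) - T' (s i g)) \<partial>M) \<longlonglongrightarrow> 0"
    proof (rule tendsto_sandwich[OF _ _ tendsto_const s(2)])
      show "\<forall>\<^sub>F i in sequentially. (\<integral>\<^sup>+ g. norm (T' (F g) - T' (s i g)) \<partial>M)
          \<le> (\<integral>\<^sup>+ g. norm (F g - s i g) \<partial>M)"
        using norm_T' by (intro always_eventually allI nn_integral_mono)
          (simp flip: linear_diff[OF bounded_linear.linear[OF T']])
    qed simp
    show "(\<lambda>i. Bochner_Integration.simple_bochner_integral M (\<lambda>g. T' (s i g))) \<longlonglongrightarrow> T' x"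
      using bounded_linear.tendsto[OF T' s(3)]
      by (simp add: simple_bochner_integral_linear[OF bounded_linear.linear[OF T'] s(1)])
  qed
  then have "has_bochner_integral M (\<lambda>g. K *\<^sub>R T' (F g)) (K *\<^sub>R T' x)"
    by (intro has_bochner_integral_scaleR_right) simp_all
  then show ?thesis using K(1) by (simp add: T'_def)
qed

text \<open>Justifies the definite description in \<open>banach_integral\<close>: two candidates
  agree under every bounded real functional.\<close>

lemma banach_integral_unique:
  assumes x: "has_banach_integral M F x"
    and meas: "\<And>\<eta> :: 'x::real_normed_vector \<Rightarrow> real. bounded_linear \<eta> \<Longrightarrow> (\<lambda>g. \<eta> (F g)) \<in> borel_measurable M"
  shows "banach_integral M F = x"
  unfolding banach_integral_def
proof (rule the_equality[of _ x])
  fix y assume y: "has_banach_integral M F y"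
  show "y = x"
  proof (rule bounded_functionals_separate)
    fix \<eta> :: "'x \<Rightarrow> real" assume \<eta>: "bounded_linear \<eta>"
    show "\<eta> y = \<eta> x"
      using has_banach_integral_bounded_linear[OF x \<eta> meas[OF \<eta>]]
        has_banach_integral_bounded_linear[OF y \<eta> meas[OF \<eta>]]
      by (metis has_bochner_integral_integral_eq)
  qed
qed (rule x)

locale averaged_system =
  fixes \<rho> :: "'g::topological_semigroup_mult measure"
    and \<alpha> :: "'g \<Rightarrow> 'a::unital_cstar_algebra \<Rightarrow> 'a"
    and I :: "'i set" and le :: "'i \<Rightarrow> 'i \<Rightarrow> bool" and f :: "'i \<Rightarrow> 'g \<Rightarrow> real"
  assumes system: "cstar_dynamical_system \<alpha>"
    and sets_\<rho>: "sets \<rho> = sets borel"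
    and orbit_measurable: "\<And>a. (\<lambda>g. \<alpha> g a) \<in> borel_measurable borel"
    and right_net: "right_averaging_net TYPE('a) \<rho> I le f"
    and left_net: "left_averaging_net TYPE('a) \<rho> I le f"
begin

lemma cp: "completely_positive (\<alpha> g)" and unital: "\<alpha> g 1 = 1" and action: "\<alpha> (g * h) a = \<alpha> g (\<alpha> h a)"
  using system by (simp_all add: cstar_dynamical_system_def)

lemmas action_clinear = completely_positive_clinear[OF cp]

lemmas action_simps = clinear_on_simps[OF action_clinear]

lemma action_cone: "a \<in> pos_cone \<Longrightarrow> \<alpha> g a \<in> pos_cone"
  by (rule completely_positive_cone[OF cp])

lemma action_star: "\<alpha> g (star a) = star (\<alpha> g a)"
  by (rule positive_map_star[OF action_clinear action_cone])

lemma action_norm_le: "norm (\<alpha> g a) \<le> norm a"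
  by (rule completely_positive_norm_le[OF cp unital])

lemma action_bounded_linear: "bounded_linear (\<alpha> g)"
  by (rule clinear_bounded_linear[OF action_clinear, where K = 1]) (simp add: action_norm_le)

lemma directed: "directed_index I le"
  using right_net by (simp add: right_averaging_net_def integrable_net_def)

lemma eventually_index: "\<forall>\<^sub>F i in net_filter I le. i \<in> I"
  unfolding eventually_net_filter[OF directed] using directed unfolding directed_index_def by blast

lemma net_filter_nontrivial: "net_filter I le \<noteq> bot"
proof
  assume "net_filter I le = bot"
  then obtain i where "i \<in> I" "\<And>j. j \<in> I \<Longrightarrow> \<not> le i j"
    using eventually_net_filter[OF directed, of "\<lambda>_. False"] by auto
  then show False using directed unfolding directed_index_def by blast
qed

lemma weight:
  assumes "i \<in> I"
  shows "integrable \<rho> (f i)" "0 \<le> f i g" "0 < (\<integral>g. f i g \<partial>\<rho>)"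
proof -
  have w: "integrable \<rho> (f i) \<and> (\<forall>g. 0 \<le> f i g) \<and> (\<integral>g. f i g \<partial>\<rho>) \<noteq> 0"
    using right_net assms unfolding right_averaging_net_def integrable_net_def by blast
  then show "integrable \<rho> (f i)" "0 \<le> f i g" by blast+
  have "0 \<le> (\<integral>g. f i g \<partial>\<rho>)" using w by (intro Bochner_Integration.integral_nonneg) blast
  with w show "0 < (\<integral>g. f i g \<partial>\<rho>)" by linarith
qed

lemma orbit_image_measurable:
  fixes T :: "'a \<Rightarrow> 'b::real_normed_vector"
  assumes "bounded_linear T"
  shows "(\<lambda>g. T (\<alpha> g a)) \<in> borel_measurable borel"
  by (rule measurable_compose[OF orbit_measurable borel_measurable_continuous_onI])
    (rule linear_continuous_on[OF assms])

lemma weighted_orbit_measurable: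
  fixes T :: "'a \<Rightarrow> 'b::{real_normed_vector, second_countable_topology}"
  assumes "i \<in> I" "bounded_linear T"
  shows "(\<lambda>g. f i g *\<^sub>R T (\<alpha> g a)) \<in> borel_measurable \<rho>"
proof -
  have "(\<lambda>g. T (\<alpha> g a)) \<in> borel_measurable \<rho>"
    using orbit_image_measurable[OF assms(2)] measurable_cong_sets[OF sets_\<rho> refl] by blast
  then show ?thesis using weight(1)[OF assms(1)] by simp
qed

text \<open>The map L is carried along so that one argument covers both the orbit itself and the
  difference x - \<alpha> h x that the left net condition produces.\<close>

lemma orbit_image_has_integral:
  assumes i: "i \<in> I" and L: "bounded_linear (L :: 'a \<Rightarrow> 'a)"
  obtains x where "banach_integral \<rho> (\<lambda>g. f i g *\<^sub>R L (\<alpha> g a)) = x"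
    "has_banach_integral \<rho> (\<lambda>g. f i g *\<^sub>R L (\<alpha> g a)) x"
proof -
  obtain K where K: "K > 0" "\<And>x. norm (L x) \<le> norm x * K"
    using bounded_linear.pos_bounded[OF L] by blast
  have "norm (L (\<alpha> g a)) \<le> norm a * K" for g
    using order_trans[OF K(2)[of "\<alpha> g a"] mult_right_mono[OF action_norm_le]] K(1) by simp
  then have "bounded (range (\<lambda>g. L (\<alpha> g a)))" by (auto simp: bounded_iff)
  then have "banach_integrable \<rho> (\<lambda>g. f i g *\<^sub>R L (\<alpha> g a))"
    using right_net i orbit_image_measurable[OF L]
    unfolding right_averaging_net_def integrable_net_def by blast
  then obtain x where x: "has_banach_integral \<rho> (\<lambda>g. f i g *\<^sub>R L (\<alpha> g a)) x"
    unfolding banach_integrable_def by blast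
  have "(\<lambda>g. \<eta> (f i g *\<^sub>R L (\<alpha> g a))) \<in> borel_measurable \<rho>"
    if \<eta>: "bounded_linear \<eta>" for \<eta> :: "'a \<Rightarrow> real"
    using weighted_orbit_measurable[OF i bounded_linear_compose[OF \<eta> L], of a]
    by (simp add: linear_scale[OF bounded_linear.linear[OF \<eta>]])
  then have "banach_integral \<rho> (\<lambda>g. f i g *\<^sub>R L (\<alpha> g a)) = x"
    by (rule banach_integral_unique[OF x])
  with x show thesis using that by blast
qed

lemma functional_orbit_integral:
  fixes \<eta> :: "'a \<Rightarrow> 'b::{banach, second_countable_topology}"
  assumes i: "i \<in> I" and L: "bounded_linear (L :: 'a \<Rightarrow> 'a)" and \<eta>: "bounded_linear \<eta>"
  shows "has_bochner_integral \<rho> (\<lambda>g. f i g *\<^sub>R \<eta> (L (\<alpha> g a)))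
    (\<eta> (banach_integral \<rho> (\<lambda>g. f i g *\<^sub>R L (\<alpha> g a))))"
proof -
  obtain x where x: "banach_integral \<rho> (\<lambda>g. f i g *\<^sub>R L (\<alpha> g a)) = x"
    "has_banach_integral \<rho> (\<lambda>g. f i g *\<^sub>R L (\<alpha> g a)) x"
    using orbit_image_has_integral[OF i L] by metis
  note sc = linear_scale[OF bounded_linear.linear[OF \<eta>]]
  have "has_bochner_integral \<rho> (\<lambda>g. \<eta> (f i g *\<^sub>R L (\<alpha> g a))) (\<eta> x)"
    by (rule has_banach_integral_bounded_linear[OF x(2) \<eta>])
      (use weighted_orbit_measurable[OF i bounded_linear_compose[OF \<eta> L], of a] in \<open>simp add: sc\<close>)
  then show ?thesis unfolding x(1) sc .
qed

section \<open>Algebra and order of the averages\<close>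

abbreviation average :: "'a \<Rightarrow> 'i \<Rightarrow> 'a" where
  "average \<equiv> net_average \<rho> f \<alpha>"

lemma functional_average:
  fixes \<eta> :: "'a \<Rightarrow> 'b::{banach, second_countable_topology}"
  assumes i: "i \<in> I" and \<eta>: "bounded_linear \<eta>"
  shows "integrable \<rho> (\<lambda>g. f i g *\<^sub>R \<eta> (\<alpha> g a))"
    "\<eta> (average a i) = (\<integral>g. f i g *\<^sub>R \<eta> (\<alpha> g a) \<partial>\<rho>) /\<^sub>R (\<integral>g. f i g \<partial>\<rho>)"
  using functional_orbit_integral[OF i bounded_linear_ident \<eta>, of a]
  by (simp_all add: has_bochner_integral_iff net_average_def linear_scale[OF bounded_linear.linear[OF \<eta>]])

text \<open>Shifts the algebra of averages to scalar integrals, where sums of integrands remain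
  measurable.\<close>

lemma average_eqI:
  assumes "i \<in> I"
    "\<And>\<eta> :: 'a \<Rightarrow> real. bounded_linear \<eta> \<Longrightarrow>
      \<eta> x = (\<integral>g. f i g *\<^sub>R \<eta> (\<alpha> g a) \<partial>\<rho>) /\<^sub>R (\<integral>g. f i g \<partial>\<rho>)"
  shows "average a i = x"
  by (rule bounded_functionals_separate) (simp only: assms(2) functional_average(2)[OF assms(1)])

text \<open>L is only asked to be real linear, so that the involution is covered along with the
  complex scalars.\<close>

lemma average_intertwine:
  assumes i: "i \<in> I" and L: "bounded_linear (L :: 'a \<Rightarrow> 'a)" "\<And>g a. \<alpha> g (L a) = L (\<alpha> g a)"
  shows "average (L a) i = L (average a i)"
proof (rule average_eqI[OF i])
  fix \<eta> :: "'a \<Rightarrow> real" assume "bounded_linear \<eta>"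
  from functional_average(2)[OF i bounded_linear_compose[OF this L(1)]]
  show "\<eta> (L (average a i)) = (\<integral>g. f i g *\<^sub>R \<eta> (\<alpha> g (L a)) \<partial>\<rho>) /\<^sub>R (\<integral>g. f i g \<partial>\<rho>)"
    by (simp add: L(2))
qed

lemma average_scaleC: "i \<in> I \<Longrightarrow> average (c *\<^sub>C a) i = c *\<^sub>C average a i"
  by (rule average_intertwine) (simp_all add: bounded_linear_scaleC action_simps)

lemma average_scaleR: "i \<in> I \<Longrightarrow> average (r *\<^sub>R a) i = r *\<^sub>R average a i"
  unfolding scaleR_scaleC by (rule average_scaleC)

lemma average_star: "i \<in> I \<Longrightarrow> average (star a) i = star (average a i)"
  by (rule average_intertwine) (simp_all add: bounded_linear_star action_star)

lemma average_add:
  assumes i: "i \<in> I"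
  shows "average (a + b) i = average a i + average b i"
proof (rule average_eqI[OF i])
  fix \<eta> :: "'a \<Rightarrow> real" assume \<eta>: "bounded_linear \<eta>"
  show "\<eta> (average a i + average b i) =
      (\<integral>g. f i g *\<^sub>R \<eta> (\<alpha> g (a + b)) \<partial>\<rho>) /\<^sub>R (\<integral>g. f i g \<partial>\<rho>)"
    using functional_average[OF i \<eta>]
    by (simp add: linear_add[OF bounded_linear.linear[OF \<eta>]] action_simps distrib_left)
qed

lemma average_diff: "i \<in> I \<Longrightarrow> average (a - b) i = average a i - average b i"
  using average_add[of i a "- b"] average_scaleR[of i "-1" b] by simp

text \<open>Invariance is asked at the single point a. Hence T may be an invariant functional or
  projection, but also the identity or an arbitrary state if a is a fixed point.\<close>

lemma invariant_map_average:
  fixes T :: "'a \<Rightarrow> 'b::real_normed_vector"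
  assumes i: "i \<in> I" and T: "bounded_linear T" "\<And>g. T (\<alpha> g a) = T a"
  shows "T (average a i) = T a"
proof (rule bounded_functionals_separate)
  fix \<eta> :: "'b \<Rightarrow> real" assume "bounded_linear \<eta>"
  from functional_average(2)[OF i bounded_linear_compose[OF this T(1)], of a]
  show "\<eta> (T (average a i)) = \<eta> (T a)"
    using weight(3)[OF i] by (simp add: T(2))
qed

lemma average_fixed:
  assumes "i \<in> I" "a \<in> fixed_system \<alpha>"
  shows "average a i = a"
  using invariant_map_average[OF assms(1) bounded_linear_ident, of a] assms(2)
  by (simp add: fixed_system_def)

lemma norm_average_le:
  assumes i: "i \<in> I"
  shows "norm (average a i) \<le> norm a"
proof -
  obtain \<eta> :: "'a \<Rightarrow> real" where \<eta>: "bounded_linear \<eta>" "\<And>x. \<bar>\<eta> x\<bar> \<le> norm x"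
    "\<eta> (average a i) = norm (average a i)"
    using norming_functional by metis
  have "(\<integral>g. f i g *\<^sub>R \<eta> (\<alpha> g a) \<partial>\<rho>) \<le> (\<integral>g. f i g * norm a \<partial>\<rho>)"
  proof (rule integral_mono)
    show "f i g *\<^sub>R \<eta> (\<alpha> g a) \<le> f i g * norm a" for g
      using mult_left_mono[OF order_trans[OF abs_ge_self order_trans[OF \<eta>(2) action_norm_le]] weight(2)[OF i]]
      by simp
  qed (use functional_average(1)[OF i \<eta>(1)] weight(1)[OF i] in auto)
  then show ?thesis
    using functional_average(2)[OF i \<eta>(1), of a] \<eta>(3) weight(3)[OF i]
    by (simp add: divide_le_eq mult.commute divide_inverse_commute[symmetric])
qed

text \<open>Positivity is read off from norms: averaging fixes 1 and contracts, so it preserves the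
  inequality that defines \<open>pos_cone\<close>.\<close>

lemma average_cone:
  assumes i: "i \<in> I" and a: "a \<in> pos_cone"
  shows "average a i \<in> pos_cone"
proof (rule coneI)
  show "star (average a i) = average a i"
    using average_star[OF i, of a] a by (simp add: cone_selfadjoint)
  have "1 \<in> fixed_system \<alpha>" by (simp add: fixed_system_def unital)
  then have "average (norm a *\<^sub>R 1 - a) i = norm a *\<^sub>R 1 - average a i"
    using i by (simp add: average_diff average_scaleR average_fixed)
  then show "norm (norm a *\<^sub>R 1 - average a i) \<le> norm a"
    using norm_average_le[OF i, of "norm a *\<^sub>R 1 - a"] norm_scale_minus_cone_le[OF a order_refl] by simp
qed

text \<open>For F g = \<alpha> g a the difference F g - F (g h) is the orbit of a - \<alpha> h a, so
  the right net condition speaks about averages of coboundaries.\<close>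

lemma right_net_average: "(average (a - \<alpha> h a) \<longlongrightarrow> 0) (net_filter I le)"
proof -
  have "bounded (range (\<lambda>g. \<alpha> g a))" using action_norm_le by (auto simp: bounded_iff)
  then have "((\<lambda>i. banach_integral \<rho> (\<lambda>g. f i g *\<^sub>R (\<alpha> g a - \<alpha> (g * h) a)) /\<^sub>R (\<integral>g. f i g \<partial>\<rho>))
      \<longlongrightarrow> 0) (net_filter I le)"
    using right_net orbit_measurable unfolding right_averaging_net_def by blast
  then show ?thesis by (simp add: net_average_def[abs_def] action action_simps)
qed

text \<open>Here F g - F (h g) is the image of the orbit under L = id - \<alpha> h. Once L is pulled
  out of the integral, with functionals as tests, the left net condition says that averages become
  asymptotically fixed.\<close>

lemma left_net_average: "((\<lambda>i. average a i - \<alpha> h (average a i)) \<longlongrightarrow> 0) (net_filter I le)"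
proof -
  define L where "L = (\<lambda>x. x - \<alpha> h x)"
  have L: "bounded_linear L"
    unfolding L_def by (intro bounded_linear_sub bounded_linear_ident action_bounded_linear)
  have "bounded (range (\<lambda>g. \<alpha> g a))" using action_norm_le by (auto simp: bounded_iff)
  then have "((\<lambda>i. banach_integral \<rho> (\<lambda>g. f i g *\<^sub>R (\<alpha> g a - \<alpha> (h * g) a)) /\<^sub>R (\<integral>g. f i g \<partial>\<rho>))
      \<longlongrightarrow> 0) (net_filter I le)"
    using left_net orbit_measurable unfolding left_averaging_net_def by blast
  then have lim: "((\<lambda>i. banach_integral \<rho> (\<lambda>g. f i g *\<^sub>R L (\<alpha> g a)) /\<^sub>R (\<integral>g. f i g \<partial>\<rho>))
      \<longlongrightarrow> 0) (net_filter I le)"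
    by (simp add: action L_def)
  have "banach_integral \<rho> (\<lambda>g. f i g *\<^sub>R L (\<alpha> g a)) /\<^sub>R (\<integral>g. f i g \<partial>\<rho>) = L (average a i)"
    if i: "i \<in> I" for i
  proof (rule bounded_functionals_separate)
    fix \<eta> :: "'a \<Rightarrow> real" assume \<eta>: "bounded_linear \<eta>"
    show "\<eta> (banach_integral \<rho> (\<lambda>g. f i g *\<^sub>R L (\<alpha> g a)) /\<^sub>R (\<integral>g. f i g \<partial>\<rho>)) = \<eta> (L (average a i))"
      using functional_orbit_integral[OF i L \<eta>, of a]
        functional_average(2)[OF i bounded_linear_compose[OF \<eta> L], of a]
      by (simp add: has_bochner_integral_iff linear_scale[OF bounded_linear.linear[OF \<eta>]])
  qed
  then have "\<forall>\<^sub>F i in net_filter I le.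
      banach_integral \<rho> (\<lambda>g. f i g *\<^sub>R L (\<alpha> g a)) /\<^sub>R (\<integral>g. f i g \<partial>\<rho>) = L (average a i)"
    using eventually_index by (auto elim: eventually_mono)
  from tendsto_cong[OF this] lim show ?thesis by (simp add: L_def)
qed

end

section \<open>States\<close>

lemma complex_subspaceD:
  assumes "csubspace B"
  shows "0 \<in> B" "a \<in> B \<Longrightarrow> b \<in> B \<Longrightarrow> a + b \<in> B" "a \<in> B \<Longrightarrow> c *\<^sub>C a \<in> B"
    "a \<in> B \<Longrightarrow> r *\<^sub>R a \<in> B" "a \<in> B \<Longrightarrow> b \<in> B \<Longrightarrow> a - b \<in> B"
  using assms complex_vector.subspace_diff[of B a b]
  by (auto simp: complex_vector.subspace_def scaleR_scaleC)

lemma complex_subspace_imp_subspace: "csubspace B \<Longrightarrow> subspace B"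
  unfolding subspace_def using complex_subspaceD by blast

text \<open>Common ground of the whole algebra and the fixed points, so that facts about states are
  proved once for both.\<close>

definition star_subspace :: "'a::unital_cstar_algebra set \<Rightarrow> bool" where
  "star_subspace B \<longleftrightarrow> csubspace B \<and> 1 \<in> B \<and> (\<forall>b\<in>B. star b \<in> B)"

lemma star_subspace_parts:
  assumes "star_subspace B" "a \<in> B"
  shows "re_part a \<in> B" "im_part a \<in> B"
proof -
  have "csubspace B" using assms(1) by (simp add: star_subspace_def)
  note D = complex_subspaceD[OF this]
  have re: "re_part b \<in> B" if "b \<in> B" for b
    unfolding re_part_def using assms(1) that by (intro D) (auto simp: star_subspace_def)
  show "re_part a \<in> B" using assms(2) by (rule re)
  have "(- \<i>) *\<^sub>C a \<in> B" using D(3) assms(2) .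
  then show "im_part a \<in> B" unfolding im_part_def using re by (simp add: scaleC_minus_left)
qed

lemma star_subspace_UNIV: "star_subspace UNIV"
  by (simp add: star_subspace_def complex_vector.subspace_UNIV)

text \<open>The positive element \<open>norm a *\<^sub>R 1 - a\<close> lies in B, so \<mu> takes a
  nonnegative real value there, from which both claims are read off.\<close>

lemma state_on_selfadjoint:
  assumes B: "star_subspace B" and \<mu>: "state_on B \<mu>" and a: "a \<in> B" "star a = a"
  shows "Im (\<mu> a) = 0" "Re (\<mu> a) \<le> norm a"
proof -
  have "csubspace B" "1 \<in> B" using B by (simp_all add: star_subspace_def)
  note D = complex_subspaceD[OF this(1)]
  have lin: "\<mu> (x + y) = \<mu> x + \<mu> y" "\<mu> (c *\<^sub>C x) = c *\<^sub>C \<mu> x" if "x \<in> B" "y \<in> B" for x y c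
    using \<mu> that by (auto simp: state_on_def clinear_on_def)
  have c: "complex_of_real (norm a) *\<^sub>C 1 \<in> B" "(- 1) *\<^sub>C a \<in> B"
    by (rule D(3)[OF \<open>1 \<in> B\<close>], rule D(3)[OF a(1)])
  have e: "norm a *\<^sub>R 1 - a = complex_of_real (norm a) *\<^sub>C 1 + (- 1) *\<^sub>C a"
    by (simp add: scaleR_scaleC scaleC_minus_left)
  have "cstar_positive (norm a *\<^sub>R 1 - a)"
    unfolding cstar_positive_iff_cone by (intro norm_bound_minus_in_cone a(2)) simp
  moreover have "norm a *\<^sub>R 1 - a \<in> B" unfolding e by (intro D c)
  ultimately have "\<mu> (norm a *\<^sub>R 1 - a) \<in> \<real>\<^sub>\<ge>\<^sub>0" using \<mu> by (auto simp: state_on_def)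
  moreover have "\<mu> (norm a *\<^sub>R 1 - a) = complex_of_real (norm a) - \<mu> a"
    unfolding e lin(1)[OF c] lin(2)[OF \<open>1 \<in> B\<close> \<open>1 \<in> B\<close>] lin(2)[OF a(1) a(1)]
    using \<mu> by (simp add: state_on_def scaleC_complex_def)
  ultimately show "Im (\<mu> a) = 0" "Re (\<mu> a) \<le> norm a"
    by (auto simp: complex_nonneg_Reals_iff)
qed

lemma state_on_parts:
  assumes B: "star_subspace B" and \<mu>: "state_on B \<mu>" and a: "a \<in> B"
  shows "Re (\<mu> a) = Re (\<mu> (re_part a))" "Im (\<mu> a) = Re (\<mu> (im_part a))"
proof -
  note P = star_subspace_parts[OF B a]
  have "csubspace B" using B by (simp add: star_subspace_def)
  then have "\<i> *\<^sub>C im_part a \<in> B" using P by (intro complex_subspaceD)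
  then have "\<mu> a = \<mu> (re_part a) + \<i> * \<mu> (im_part a)"
    using re_im_decomposition[of a] \<mu> P
    by (metis (no_types, lifting) clinear_on_def scaleC_complex_def state_on_def)
  then show "Re (\<mu> a) = Re (\<mu> (re_part a))" "Im (\<mu> a) = Re (\<mu> (im_part a))"
    using state_on_selfadjoint(1)[OF B \<mu> P(1)] state_on_selfadjoint(1)[OF B \<mu> P(2)] by simp_all
qed

text \<open>A phase c turns \<mu> a into its modulus, after which only the self-adjoint part of c a
  matters; this yields the sharp constant 1. If \<mu> a = 0 the chosen c is 0, hence the inequality
  \<open>cmod c \<le> 1\<close> instead of an equality.\<close>

lemma state_on_norm_le:
  assumes B: "star_subspace B" and \<mu>: "state_on B \<mu>" and a: "a \<in> B"
  shows "cmod (\<mu> a) \<le> norm a"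
proof -
  define c where "c = cnj (sgn (\<mu> a))"
  have c: "cmod c \<le> 1" by (simp add: c_def norm_sgn)
  have cB: "c *\<^sub>C a \<in> B" using B a by (auto simp: star_subspace_def intro: complex_subspaceD)
  have "\<mu> (c *\<^sub>C a) = c * \<mu> a"
    using \<mu> a by (simp add: state_on_def clinear_on_def scaleC_complex_def)
  also have "\<dots> = complex_of_real (cmod (\<mu> a))"
  proof (cases "\<mu> a = 0")
    case False
    then show ?thesis
      using complex_norm_square[of "\<mu> a"]
      by (simp add: c_def sgn_div_norm scaleR_conv_of_real field_simps power2_eq_square)
  qed simp
  finally have "cmod (\<mu> a) = Re (\<mu> (c *\<^sub>C a))" by simp
  also have "\<dots> \<le> norm (re_part (c *\<^sub>C a))"
    unfolding state_on_parts(1)[OF B \<mu> cB]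
    by (rule state_on_selfadjoint(2)[OF B \<mu> star_subspace_parts(1)[OF B cB] star_re_part])
  also have "\<dots> \<le> norm (c *\<^sub>C a)" by (rule norm_re_part_le)
  also have "\<dots> \<le> norm a" using mult_right_mono[OF c, of "norm a"] by (simp add: norm_scaleC)
  finally show ?thesis .
qed

lemma state_clinear: "state_on UNIV \<phi> \<Longrightarrow> clinear_on UNIV \<phi>"
  by (simp add: state_on_def)

lemma state_bounded_linear: "state_on UNIV \<phi> \<Longrightarrow> bounded_linear \<phi>"
  by (rule clinear_bounded_linear[OF state_clinear, where K = 1])
    (simp_all add: state_on_norm_le[OF star_subspace_UNIV])

definition complexification :: "('a::unital_cstar_algebra \<Rightarrow> real) \<Rightarrow> 'a \<Rightarrow> complex" where
  "complexification h a = Complex (h a) (- h (\<i> *\<^sub>C a))"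

text \<open>Hermitian symmetry gives h (i a) = h (- i a), so h (i a) = 0 for self-adjoint a. The
  complex functional with real part h is therefore real on self-adjoint elements.\<close>

lemma complexification_state:
  fixes h :: "'a::unital_cstar_algebra \<Rightarrow> real"
  assumes h: "linear h" "\<And>a. h (star a) = h a" "\<And>a. a \<in> pos_cone \<Longrightarrow> h a \<ge> 0" "h 1 = 1"
  shows "state_on UNIV (complexification h)"
proof -
  note lin = linear_add[OF h(1)] linear_scale[OF h(1)] linear_neg[OF h(1)] linear_diff[OF h(1)]
  have sa: "h (\<i> *\<^sub>C a) = 0" if "star a = a" for a
    using h(2)[of "\<i> *\<^sub>C a"] that by (simp add: star_scaleC scaleC_minus_left lin)
  have "clinear_on UNIV (complexification h)"
    unfolding clinear_on_def
  proof (intro conjI allI ballI)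
    show "complexification h (a + b) = complexification h a + complexification h b" for a b
      by (simp add: complexification_def scaleC_add_right lin complex_eq_iff)
    fix c and a :: 'a
    have c: "c *\<^sub>C a = Re c *\<^sub>R a + Im c *\<^sub>R (\<i> *\<^sub>C a)"
      by (simp add: scaleR_scaleC scaleC_scaleC complex_eq_iff flip: scaleC_add_left)
    have "\<i> *\<^sub>C c *\<^sub>C a = Re c *\<^sub>R (\<i> *\<^sub>C a) - Im c *\<^sub>R a"
      unfolding c by (simp add: scaleC_add_right scaleC_scaleR_commute)
    then have "h (\<i> *\<^sub>C c *\<^sub>C a) = Re c * h (\<i> *\<^sub>C a) - Im c * h a" by (simp add: lin)
    moreover have "h (c *\<^sub>C a) = Re c * h a + Im c * h (\<i> *\<^sub>C a)" unfolding c by (simp add: lin)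
    ultimately show "complexification h (c *\<^sub>C a) = c *\<^sub>C complexification h a"
      by (simp add: complexification_def scaleC_complex_def complex_eq_iff)
  qed
  moreover have "complexification h a \<in> \<real>\<^sub>\<ge>\<^sub>0" if "cstar_positive a" for a
    using that h(3)[of a] sa[of a]
    by (simp add: cstar_positive_iff_cone complexification_def complex_nonneg_Reals_iff cone_selfadjoint)
  moreover have "complexification h 1 = 1"
    using sa[of 1] h(4) by (simp add: complexification_def complex_eq_iff)
  ultimately show ?thesis by (simp add: state_on_def)
qed

text \<open>The dominating functional p is the upper end of the spectrum of
  \<open>re_part x\<close>, expressed through the order. A real functional below it is automatically
  hermitian, positive and normalised. At b or at - b the value of p is positive, since otherwise b
  would lie between - e and e for every e > 0; Hahn--Banach is applied at that point.\<close>

lemma states_detect_selfadjoint: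
  fixes b :: "'a::unital_cstar_algebra"
  assumes b: "star b = b" "b \<noteq> 0"
  obtains \<phi> where "state_on UNIV \<phi>" "\<phi> b \<noteq> 0"
proof -
  define S :: "'a \<Rightarrow> real set" where "S = (\<lambda>x. {t. t *\<^sub>R 1 - re_part x \<in> pos_cone})"
  have memS: "t \<in> S x \<longleftrightarrow> t *\<^sub>R 1 - re_part x \<in> pos_cone" for t x by (simp add: S_def)
  have normS: "norm x \<in> S x" for x
    unfolding memS by (intro norm_bound_minus_in_cone norm_re_part_le) simp
  have bdd: "bdd_below (S x)" for x
  proof (rule bdd_belowI)
    fix t assume "t \<in> S x"
    moreover have "norm x *\<^sub>R 1 + re_part x \<in> pos_cone"
      using normS[of "- x"] by (simp add: memS re_part_minus)
    ultimately have "(t *\<^sub>R 1 - re_part x) + (norm x *\<^sub>R 1 + re_part x) \<in> pos_cone"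
      unfolding memS by (rule cone_add)
    then have r: "(t + norm x) *\<^sub>R (1::'a) \<in> pos_cone" by (simp add: scaleR_add_left)
    show "- norm x \<le> t"
    proof (rule ccontr)
      assume "\<not> - norm x \<le> t"
      then have "- (t + norm x) \<ge> 0" by simp
      then have "(- (t + norm x)) *\<^sub>R (1::'a) \<in> pos_cone" by (rule cone_one_scale)
      then have "- ((t + norm x) *\<^sub>R (1::'a)) \<in> pos_cone" unfolding scaleR_minus_left .
      with r have "(t + norm x) *\<^sub>R (1::'a) = 0" by (rule cone_antisym)
      then show False using \<open>\<not> - norm x \<le> t\<close> by simp
    qed
  qed
  define p where "p = (\<lambda>x. Inf (S x))"
  have low: "p x \<le> t" if "t *\<^sub>R 1 - re_part x \<in> pos_cone" for x t
    unfolding p_def by (rule cInf_lower[OF _ bdd]) (simp add: memS that)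
  have sub: "sublinear p" unfolding p_def
  proof (rule sublinear_Inf[OF _ bdd])
    show "S x \<noteq> {}" for x using normS by blast
    show "\<exists>c\<in>S (x + y). c \<le> s + t" if "s \<in> S x" "t \<in> S y" for x y s t
    proof (rule bexI[of _ "s + t"])
      have "(s *\<^sub>R 1 - re_part x) + (t *\<^sub>R 1 - re_part y) \<in> pos_cone"
        using that unfolding memS by (rule cone_add)
      then show "s + t \<in> S (x + y)" unfolding memS by (simp add: re_part_add algebra_simps)
    qed simp
    show "\<exists>c\<in>S (r *\<^sub>R x). c \<le> r * t" if "r > 0" "t \<in> S x" for x t r
    proof (rule bexI[of _ "r * t"])
      have "r *\<^sub>R (t *\<^sub>R 1 - re_part x) \<in> pos_cone" using that unfolding memS by (intro cone_scaleR) auto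
      then show "r * t \<in> S (r *\<^sub>R x)" unfolding memS by (simp add: re_part_scaleR scaleR_diff_right)
    qed simp
    show "\<exists>c\<in>S 0. c \<le> 0" using normS[of 0] by (intro bexI[of _ 0]) auto
  qed
  \<comment> \<open>An infimum at most 0 yields an admissible s < t, and the gap t - s is filled by
    a multiple of 1.\<close>
  have up: "t *\<^sub>R 1 - x \<in> pos_cone" if x: "star x = x" "p x \<le> 0" "t > 0" for x t
  proof -
    have "Inf (S x) < t" using x(2,3) by (simp add: p_def)
    then obtain s where s: "s \<in> S x" "s < t" using cInf_lessD[of "S x"] normS by blast
    have "(t - s) *\<^sub>R 1 + (s *\<^sub>R 1 - x) \<in> pos_cone"
      using s x(1) by (intro cone_add cone_one_scale) (simp_all add: memS re_part_selfadjoint)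
    then show ?thesis by (simp add: algebra_simps)
  qed
  have "\<exists>b'. (b' = b \<or> b' = - b) \<and> p b' > 0"
  proof (rule ccontr)
    assume "\<not> ?thesis"
    then have le: "p b \<le> 0" "p (- b) \<le> 0" by (auto simp: not_less)
    have "norm b \<le> 0 + e" if "e > 0" for e
      using up[OF b(1) le(1) that] up[of "- b", OF _ le(2) that] b(1) that
        norm_le_of_order_interval[of e b] by (simp add: star_minus)
    then have "norm b \<le> 0" by (rule field_le_epsilon)
    then show False using b(2) by simp
  qed
  then obtain b' where b': "b' = b \<or> b' = - b" "p b' > 0" by blast
  obtain h where h: "linear h" "\<And>x. h x \<le> p x" "h b' = p b'"
    using Hahn_Banach_sublinear[OF sub] by metis
  have hle: "h x \<le> t" if "t *\<^sub>R 1 - re_part x \<in> pos_cone" for x t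
    using order_trans[OF h(2) low[OF that]] .
  note lin = linear_neg[OF h(1)] linear_diff[OF h(1)]
  have st: "state_on UNIV (complexification h)"
  proof (rule complexification_state[OF h(1)])
    \<comment> \<open>The self-adjoint part of \<open>a - star a\<close> is 0, so 0 is an admissible
      bound; exchanging a and \<open>star a\<close> gives equality.\<close>
    have "h (a - star a) \<le> 0" for a
      by (rule hle) (simp add: re_part_def star_diff star_star cone_zero)
    from this this[of "star a" for a] show "h (star a) = h a" for a
      by (simp add: lin star_star order.antisym)
    show "h a \<ge> 0" if "a \<in> pos_cone" for a
      using hle[of 0 "- a"] that by (simp add: lin re_part_minus re_part_selfadjoint cone_selfadjoint)
    show "h 1 = 1"
      using hle[of 1 1] hle[of "-1" "-1"]
      by (simp add: lin re_part_minus re_part_selfadjoint cone_zero)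
  qed
  have "h b \<noteq> 0" using b' h(3) by (auto simp: lin)
  then have "complexification h b \<noteq> 0" by (simp add: complexification_def complex_eq_iff)
  with st show thesis using that by blast
qed

lemma states_separate:
  fixes x y :: "'a::unital_cstar_algebra"
  assumes "\<And>\<phi>. state_on UNIV \<phi> \<Longrightarrow> \<phi> x = \<phi> y"
  shows "x = y"
proof -
  have "\<phi> (x - y) = 0" if "state_on UNIV \<phi>" for \<phi>
    using assms[OF that] by (simp add: clinear_on_simps[OF state_clinear[OF that]])
  then have z: "\<phi> (re_part (x - y)) = 0 \<and> \<phi> (im_part (x - y)) = 0" if "state_on UNIV \<phi>" for \<phi>
    using that state_on_parts[OF star_subspace_UNIV that, of "x - y"]
      state_on_selfadjoint(1)[OF star_subspace_UNIV that, of "re_part (x - y)"]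
      state_on_selfadjoint(1)[OF star_subspace_UNIV that, of "im_part (x - y)"]
    by (simp add: complex_eq_iff)
  have "re_part (x - y) = 0" "im_part (x - y) = 0"
    using z states_detect_selfadjoint star_re_part star_im_part by metis+
  then show ?thesis using re_im_decomposition[of "x - y"] by simp
qed

text \<open>Self-adjoint a is tested together with i t for all real t: the squared norm of a + i t
  is at most norm a squared plus t^2, which leaves no room for a term linear in t, so \<eta> a is
  real. Positivity follows since \<eta> maps \<open>norm a *\<^sub>R 1 - a\<close> into the disc of
  radius \<open>norm a\<close>.\<close>

lemma contractive_unital_functional_state:
  fixes \<eta> :: "'a::unital_cstar_algebra \<Rightarrow> complex"
  assumes \<eta>: "clinear_on UNIV \<eta>" "\<And>a. cmod (\<eta> a) \<le> norm a" "\<eta> 1 = 1"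
  shows "state_on UNIV \<eta>"
proof -
  note lin = clinear_on_simps[OF \<eta>(1)]
  have im: "Im (\<eta> a) = 0" if a: "star a = a" for a
  proof -
    have bound: "(Re (\<eta> a))\<^sup>2 + (Im (\<eta> a) + t)\<^sup>2 \<le> (norm a)\<^sup>2 + t\<^sup>2" for t
    proof -
      define u where "u = a + (\<i> * complex_of_real t) *\<^sub>C 1"
      have su: "star u = a - (\<i> * complex_of_real t) *\<^sub>C 1"
        by (simp add: u_def star_add star_scaleC a scaleC_minus_left)
      have "star u * u = a * a + (t\<^sup>2) *\<^sub>R 1"
        unfolding su unfolding u_def
        by (simp add: algebra_simps mult_scaleC_left mult_scaleC_right scaleC_scaleC
            scaleC_minus_left scaleR_scaleC power2_eq_square)
      then have "(norm u)\<^sup>2 \<le> norm (a * a) + t\<^sup>2"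
        using cstar_identity[of u] norm_triangle_ineq[of "a * a" "(t\<^sup>2) *\<^sub>R 1"] by simp
      moreover have "(cmod (\<eta> u))\<^sup>2 \<le> (norm u)\<^sup>2" by (intro power_mono \<eta>(2)) simp
      moreover have "\<eta> u = \<eta> a + \<i> * complex_of_real t"
        by (simp add: u_def lin \<eta>(3) scaleC_complex_def)
      ultimately show ?thesis by (simp add: cmod_power2 norm_selfadjoint_square[OF a])
    qed
    define q where "q = Im (\<eta> a)"
    have "2 * q * t \<le> (norm a)\<^sup>2" for t
    proof -
      have "(Re (\<eta> a))\<^sup>2 + (q + t)\<^sup>2 \<le> (norm a)\<^sup>2 + t\<^sup>2" using bound[of t] by (simp add: q_def)
      moreover have "(q + t)\<^sup>2 = q\<^sup>2 + 2 * q * t + t\<^sup>2" by (simp add: power2_sum)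
      ultimately show ?thesis using zero_le_power2[of "Re (\<eta> a)"] zero_le_power2[of q] by linarith
    qed
    \<comment> \<open>For q \<noteq> 0 this t makes 2 q t equal to
      \<open>(norm a)\<^sup>2 + 1\<close>, a contradiction.\<close>
    from this[of "((norm a)\<^sup>2 + 1) / (2 * q)"] have "q = 0" by (cases "q = 0") auto
    then show ?thesis by (simp add: q_def)
  qed
  have "\<eta> a \<in> \<real>\<^sub>\<ge>\<^sub>0" if "cstar_positive a" for a
  proof -
    have a: "a \<in> pos_cone" using that by (simp add: cstar_positive_iff_cone)
    have "cmod (\<eta> (norm a *\<^sub>R 1 - a)) \<le> norm a"
      using order_trans[OF \<eta>(2) norm_scale_minus_cone_le[OF a order_refl]] .
    moreover have "\<eta> (norm a *\<^sub>R 1 - a) = complex_of_real (norm a) - \<eta> a"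
      unfolding lin \<eta>(3) of_real_def ..
    ultimately have "Re (complex_of_real (norm a) - \<eta> a) \<le> norm a"
      using complex_Re_le_cmod order_trans by metis
    then have "0 \<le> Re (\<eta> a)" by simp
    then show ?thesis using im[OF cone_selfadjoint[OF a]] by (simp add: complex_nonneg_Reals_iff)
  qed
  then show ?thesis using \<eta> by (simp add: state_on_def)
qed

section \<open>Relative unique ergodicity\<close>

context averaged_system
begin

lemma fixed_operator_system: "operator_system (fixed_system \<alpha>)"
  unfolding operator_system_def
proof (intro conjI ballI)
  show "csubspace (fixed_system \<alpha>)"
    by (auto simp: complex_vector.subspace_def fixed_system_def action_simps)
  have "fixed_system \<alpha> = (\<Inter>g. {a. \<alpha> g a = a})" by (auto simp: fixed_system_def)
  moreover have "closed {a. \<alpha> g a = a}" for g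
    by (intro closed_Collect_eq linear_continuous_on action_bounded_linear continuous_on_id)
  ultimately show "closed (fixed_system \<alpha>)" by auto
qed (auto simp: fixed_system_def unital action_star)

lemma fixed_star_subspace: "star_subspace (fixed_system \<alpha>)"
  using fixed_operator_system by (simp add: operator_system_def star_subspace_def)

lemmas fixed_subspace = complex_subspaceD[OF conjunct1[OF fixed_operator_system[unfolded operator_system_def]]]

lemma coboundary_subspace: "csubspace (cspan (coboundaries \<alpha>))"
  by (rule complex_vector.subspace_span)

lemma coboundary_in_span: "a - \<alpha> g a \<in> cspan (coboundaries \<alpha>)"
  by (rule complex_vector.span_base) (auto simp: coboundaries_def)

text \<open>A Jordan decomposition \<open>\<psi> = h - (h - \<psi>)\<close> with invariant parts. Averaging is built into
  the dominating sublinear functional, which spares both the uniqueness of the Jordan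
  decomposition and weak-* compactness.\<close>

lemma invariant_positive_majorant:
  fixes \<psi> :: "'a \<Rightarrow> real"
  assumes \<psi>: "bounded_linear \<psi>" "\<And>a. \<psi> (star a) = \<psi> a" "\<And>g a. \<psi> (\<alpha> g a) = \<psi> a"
  obtains h where "linear h" "\<And>a. h (star a) = h a" "\<And>g a. h (\<alpha> g a) = h a"
    "\<And>a. a \<in> pos_cone \<Longrightarrow> h a \<ge> 0" "\<And>a. a \<in> pos_cone \<Longrightarrow> \<psi> a \<le> h a"
proof -
  obtain c where c: "c > 0" "\<And>a. norm (\<psi> a) \<le> norm a * c"
    using bounded_linear.pos_bounded[OF \<psi>(1)] by blast
  note lin\<psi> = linear_add[OF bounded_linear.linear[OF \<psi>(1)]] linear_scale[OF bounded_linear.linear[OF \<psi>(1)]]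
    linear_neg[OF bounded_linear.linear[OF \<psi>(1)]] linear_0[OF bounded_linear.linear[OF \<psi>(1)]]
  \<comment> \<open>An order bound on the average instead of on x itself; this is what makes
    coboundaries negligible and h invariant.\<close>
  define D where "D = (\<lambda>t x i. t *\<^sub>R 1 - re_part (average x i) \<in> pos_cone)"
  \<comment> \<open>The splitting of x into z and x - z encodes both constraints on h: at x = - a,
    the choice z = 0 expresses h a \<ge> 0 and the choice z = - a expresses h a \<ge> \<psi> a. The
    term c * t is the price of order bounds that hold only up to t.\<close>
  define S where "S = (\<lambda>x. {c * t + \<psi> z | t z. t \<ge> 0 \<and>
    (\<forall>\<^sub>F i in net_filter I le. i \<in> I \<and> D t z i \<and> D t (x - z) i)})"
  have memS: "c * t + \<psi> z \<in> S x"
    if "t \<ge> 0" "\<forall>\<^sub>F i in net_filter I le. D t z i \<and> D t (x - z) i" for t z x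
    unfolding S_def using that eventually_conj[OF eventually_index that(2)] by blast
  have D_add: "D (s + t) (x + y) i" if "i \<in> I" "D s x i" "D t y i" for s t x y i
    using cone_add[OF that(2,3)[unfolded D_def]] that(1)
    by (simp add: D_def average_add re_part_add algebra_simps)
  have D_scale: "D (r * t) (r *\<^sub>R x) i" if "i \<in> I" "D t x i" "r \<ge> 0" for r t x i
    using cone_scaleR[OF that(2)[unfolded D_def] that(3)] that(1)
    by (simp add: D_def average_scaleR re_part_scaleR scaleR_diff_right)
  have D_norm: "D t x i" if "norm (average x i) \<le> t" for t x i
    unfolding D_def
    by (intro norm_bound_minus_in_cone order_trans[OF norm_re_part_le that]) simp
  have D_cone: "D 0 (- a) i" if "i \<in> I" "a \<in> pos_cone" for a i
    using average_cone[OF that] that(1) average_scaleR[OF that(1), of "-1" a]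
    by (simp add: D_def re_part_minus re_part_selfadjoint cone_selfadjoint)
  have D_zero: "D 0 0 i" if "i \<in> I" for i
    using D_cone[OF that cone_zero] by simp
  have bdd: "bdd_below (S x)" for x
  proof (rule bdd_belowI)
    fix s assume "s \<in> S x"
    then obtain t z where tz: "s = c * t + \<psi> z" "t \<ge> 0"
      "\<forall>\<^sub>F i in net_filter I le. i \<in> I \<and> D t z i \<and> D t (x - z) i" by (auto simp: S_def)
    obtain i where i: "i \<in> I" "D t z i" "D t (x - z) i"
      using eventually_happens'[OF net_filter_nontrivial tz(3)] by blast
    \<comment> \<open>The bounds for x - z and - x add up to one for - z; with the bound for z they
      enclose k between -(t + norm x) and t + norm x. As \<psi> z = \<psi> k and c bounds the norm
      of \<psi>, the term c * t absorbs the part of \<psi> z that grows with t.\<close>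
    define k where "k = re_part (average z i)"
    have "D (norm x) x i" "D (norm x) (- x) i"
      using norm_average_le[OF i(1), of x] norm_average_le[OF i(1), of "- x"] by (auto intro: D_norm)
    from D_add[OF i(1) i(3) this(2)] have "D (t + norm x) (- z) i" by simp
    moreover have "D (t + norm x) z i"
      using D_add[OF i(1) i(2) D_norm[of 0 i "norm x"]] average_diff[OF i(1), of 0 0] by simp
    ultimately have "norm k \<le> t + norm x"
      using tz(2) average_scaleR[OF i(1), of "-1" z]
      by (intro norm_le_of_order_interval) (simp_all add: D_def k_def re_part_minus)
    moreover have "\<psi> z = \<psi> (average z i)"
      using invariant_map_average[OF i(1) \<psi>(1,3)] by simp
    then have "\<psi> z = \<psi> k"
      by (simp add: k_def re_part_def lin\<psi> \<psi>(2))
    ultimately have "\<bar>\<psi> z\<bar> \<le> (t + norm x) * c"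
      using order_trans[OF c(2)[of k] mult_right_mono[of "norm k" "t + norm x" c]] c(1) by simp
    then show "- (c * norm x) \<le> s" unfolding tz(1) by (simp add: algebra_simps abs_le_iff)
  qed
  define p where "p = (\<lambda>x. Inf (S x))"
  have low: "p x \<le> c * t + \<psi> z"
    if "t \<ge> 0" "\<forall>\<^sub>F i in net_filter I le. D t z i \<and> D t (x - z) i" for t z x
    unfolding p_def by (rule cInf_lower[OF memS[OF that] bdd])
  have sub: "sublinear p" unfolding p_def
  proof (rule sublinear_Inf[OF _ bdd])
    show "S x \<noteq> {}" for x
    proof -
      have "\<forall>\<^sub>F i in net_filter I le. D (norm x) 0 i \<and> D (norm x) (x - 0) i"
        using eventually_index
      proof (rule eventually_mono)
        fix i assume i: "i \<in> I"
        show "D (norm x) 0 i \<and> D (norm x) (x - 0) i"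
          using norm_average_le[OF i, of x] average_diff[OF i, of 0 0] by (auto intro!: D_norm)
      qed
      with memS[of "norm x" 0 x] show ?thesis by auto
    qed
    show "\<exists>r\<in>S (x + y). r \<le> a + b" if ab: "a \<in> S x" "b \<in> S y" for x y a b
    proof -
      obtain s u where su: "a = c * s + \<psi> u" "s \<ge> 0"
        "\<forall>\<^sub>F i in net_filter I le. i \<in> I \<and> D s u i \<and> D s (x - u) i" using ab(1) by (auto simp: S_def)
      obtain t v where tv: "b = c * t + \<psi> v" "t \<ge> 0"
        "\<forall>\<^sub>F i in net_filter I le. i \<in> I \<and> D t v i \<and> D t (y - v) i" using ab(2) by (auto simp: S_def)
      have "\<forall>\<^sub>F i in net_filter I le. D (s + t) (u + v) i \<and> D (s + t) (x + y - (u + v)) i"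
        using su(3) tv(3)
      proof eventually_elim
        case (elim i)
        then have "D (s + t) (u + v) i" "D (s + t) ((x - u) + (y - v)) i" using D_add by blast+
        then show ?case by (simp add: algebra_simps)
      qed
      then have "c * (s + t) + \<psi> (u + v) \<in> S (x + y)" using su(2) tv(2) by (intro memS) auto
      moreover have "c * (s + t) + \<psi> (u + v) = a + b" by (simp add: su tv lin\<psi> algebra_simps)
      ultimately show ?thesis by auto
    qed
    show "\<exists>q\<in>S (r *\<^sub>R x). q \<le> r * a" if ra: "r > 0" "a \<in> S x" for x a r
    proof -
      obtain t z where tz: "a = c * t + \<psi> z" "t \<ge> 0"
        "\<forall>\<^sub>F i in net_filter I le. i \<in> I \<and> D t z i \<and> D t (x - z) i" using ra(2) by (auto simp: S_def)
      have "\<forall>\<^sub>F i in net_filter I le. D (r * t) (r *\<^sub>R z) i \<and> D (r * t) (r *\<^sub>R x - r *\<^sub>R z) i"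
        using tz(3)
      proof eventually_elim
        case (elim i)
        then have "D (r * t) (r *\<^sub>R z) i" "D (r * t) (r *\<^sub>R (x - z)) i" using D_scale ra(1) by auto
        then show ?case by (simp add: scaleR_diff_right)
      qed
      then have "c * (r * t) + \<psi> (r *\<^sub>R z) \<in> S (r *\<^sub>R x)" using ra(1) tz(2) by (intro memS) auto
      moreover have "c * (r * t) + \<psi> (r *\<^sub>R z) = r * a" by (simp add: tz lin\<psi> algebra_simps)
      ultimately show ?thesis by auto
    qed
    have "c * 0 + \<psi> 0 \<in> S 0"
      using eventually_index by (intro memS) (auto elim!: eventually_mono intro: D_zero)
    then show "\<exists>q\<in>S 0. q \<le> 0" by (auto simp: lin\<psi>)
  qed
  obtain h where h: "linear h" "\<And>x. h x \<le> p x" using Hahn_Banach_sublinear[OF sub] by metis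
  note linh = linear_neg[OF h(1)] linear_diff[OF h(1)]
  have hle: "h x \<le> c * t" if "t \<ge> 0" "\<And>i. i \<in> I \<Longrightarrow> D t x i" for t x
  proof -
    have "\<forall>\<^sub>F i in net_filter I le. D t 0 i \<and> D t (x - 0) i"
      using eventually_index
    proof (rule eventually_mono)
      fix i assume "i \<in> I"
      then show "D t 0 i \<and> D t (x - 0) i"
        using that average_diff[of i 0 0] by (auto intro!: D_norm)
    qed
    then have "p x \<le> c * t + \<psi> 0" by (rule low[OF that(1)])
    then show ?thesis using h(2)[of x] by (simp add: lin\<psi>)
  qed
  show thesis
  proof (rule that[OF h(1)])
    have "h (a - star a) \<le> 0" for a
    proof -
      have "re_part (average (a - star a) i) = 0" if "i \<in> I" for i
        by (simp add: average_diff[OF that] average_star[OF that] re_part_def star_diff star_star)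
      then show ?thesis using hle[of 0 "a - star a"] by (simp add: D_def cone_zero)
    qed
    from this this[of "star a" for a] show "h (star a) = h a" for a
      by (simp add: linh star_star order.antisym)
    \<comment> \<open>The averages of a coboundary eventually have norm below e / c, so t = e / c is
      admissible with z = 0 and costs only e. Replacing a by - a turns the inequality into an
      equality.\<close>
    have coboundary: "h (a - \<alpha> g a) \<le> 0" for g a
    proof (rule field_le_epsilon)
      fix e :: real assume e: "e > 0"
      have "\<forall>\<^sub>F i in net_filter I le. norm (average (a - \<alpha> g a) i) < e / c"
        using tendstoD[OF right_net_average, of "e / c" a g] e c(1) by simp
      with eventually_index
      have "\<forall>\<^sub>F i in net_filter I le. D (e / c) 0 i \<and> D (e / c) ((a - \<alpha> g a) - 0) i"
      proof eventually_elim
        case (elim i)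
        then show ?case using average_diff[of i 0 0] e c(1) by (auto intro!: D_norm)
      qed
      then have "p (a - \<alpha> g a) \<le> c * (e / c) + \<psi> 0" using e c(1) by (intro low) auto
      then show "h (a - \<alpha> g a) \<le> 0 + e" using h(2)[of "a - \<alpha> g a"] c(1) by (simp add: lin\<psi>)
    qed
    show "h (\<alpha> g a) = h a" for g a
      using coboundary[of a g] coboundary[of "- a" g] by (simp add: action_simps linh)
    show "h a \<ge> 0" if "a \<in> pos_cone" for a
      using hle[of 0 "- a"] D_cone that by (simp add: linh)
    \<comment> \<open>The splitting of - a with z = - a and t = 0: the averages of - a are negative,
      and the rest is 0.\<close>
    show "\<psi> a \<le> h a" if a: "a \<in> pos_cone" for a
    proof -
      have "\<forall>\<^sub>F i in net_filter I le. D 0 (- a) i \<and> D 0 (- a - - a) i"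
        using eventually_index by (rule eventually_mono) (simp add: D_cone a D_zero)
      then have "p (- a) \<le> c * 0 + \<psi> (- a)" by (rule low[OF order_refl])
      then show ?thesis using h(2)[of "- a"] by (simp add: linh lin\<psi>)
    qed
  qed
qed

text \<open>Hahn--Banach yields a real functional k without symmetry. It is nonzero at
  \<open>re_part z\<close> or at i times \<open>im_part z\<close>, so composing it with
  \<open>re_part\<close> and with multiplication by u = 1 or u = i makes it hermitian and keeps it
  nonzero. Both summands of W are complex subspaces, so they absorb the factor u.\<close>

lemma invariant_annihilator:
  assumes "\<not> dense_decomposition \<alpha>"
  obtains \<psi> :: "'a \<Rightarrow> real" where "bounded_linear \<psi>" "\<And>a. \<psi> (star a) = \<psi> a"
    "\<And>g a. \<psi> (\<alpha> g a) = \<psi> a" "\<And>b. b \<in> fixed_system \<alpha> \<Longrightarrow> \<psi> b = 0" "\<exists>a. \<psi> a \<noteq> 0"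
proof -
  define W where "W = {x + y | x y. x \<in> fixed_system \<alpha> \<and> y \<in> cspan (coboundaries \<alpha>)}"
  have "subspace (fixed_system \<alpha>)" "subspace (cspan (coboundaries \<alpha>))"
    using fixed_operator_system coboundary_subspace
    by (auto simp: operator_system_def intro: complex_subspace_imp_subspace)
  then have sW: "subspace W" unfolding W_def by (rule subspace_sums)
  have FW: "b \<in> W" if "b \<in> fixed_system \<alpha>" for b
    unfolding W_def using that complex_subspaceD(1)[OF coboundary_subspace] by force
  have NW: "y \<in> W" if "y \<in> cspan (coboundaries \<alpha>)" for y
    unfolding W_def using that fixed_subspace(1) by force
  obtain z where "z \<notin> closure W" using assms by (auto simp: dense_decomposition_def W_def)
  then obtain k :: "'a \<Rightarrow> real" where k: "bounded_linear k" "\<And>x. x \<in> W \<Longrightarrow> k x = 0" "k z \<noteq> 0"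
    using annihilating_functional[OF sW] by metis
  note lin = linear_add[OF bounded_linear.linear[OF k(1)]] linear_diff[OF bounded_linear.linear[OF k(1)]]
  have "k (1 *\<^sub>C re_part z) + k (\<i> *\<^sub>C im_part z) \<noteq> 0"
    using k(3) re_im_decomposition[of z] by (simp flip: lin(1))
  then have "k (1 *\<^sub>C re_part z) \<noteq> 0 \<or> k (\<i> *\<^sub>C im_part z) \<noteq> 0" by auto
  then obtain u b where ub: "k (u *\<^sub>C b) \<noteq> 0" "star b = b"
    using star_re_part[of z] star_im_part[of z] by blast
  define \<psi> where "\<psi> = (\<lambda>a. k (u *\<^sub>C re_part a))"
  have bl: "bounded_linear (re_part :: 'a \<Rightarrow> 'a)"
    by (rule bounded_linear_intro[where K = 1])
      (simp_all add: re_part_add re_part_scaleR norm_re_part_le)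
  show thesis
  proof (rule that[of \<psi>])
    show "bounded_linear \<psi>"
      unfolding \<psi>_def by (intro bounded_linear_compose[OF k(1)] bounded_linear_compose[OF bounded_linear_scaleC] bl)
    show "\<psi> (star a) = \<psi> a" for a by (simp add: \<psi>_def re_part_def star_star add.commute)
    show "\<psi> (\<alpha> g a) = \<psi> a" for g a
    proof -
      have "re_part (\<alpha> g a) = \<alpha> g (re_part a)"
        by (simp add: re_part_def action_simps action_star)
      then have "u *\<^sub>C re_part a - u *\<^sub>C re_part (\<alpha> g a) = u *\<^sub>C (re_part a - \<alpha> g (re_part a))"
        by (simp add: scaleC_diff_right)
      also have "\<dots> \<in> W"
        by (intro NW complex_subspaceD(3)[OF coboundary_subspace] coboundary_in_span)
      finally show ?thesis using k(2) by (fastforce simp: \<psi>_def lin)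
    qed
    show "\<psi> b = 0" if "b \<in> fixed_system \<alpha>" for b
      unfolding \<psi>_def
      by (intro k(2) FW fixed_subspace(3) star_subspace_parts[OF fixed_star_subspace] that)
    show "\<exists>a. \<psi> a \<noteq> 0" using ub by (intro exI[of _ b]) (simp add: \<psi>_def re_part_selfadjoint)
  qed
qed

lemma uniquely_ergodic_imp_dense:
  assumes "uniquely_ergodic_rel_fixed \<alpha>"
  shows "dense_decomposition \<alpha>"
proof (rule ccontr)
  assume "\<not> dense_decomposition \<alpha>"
  then obtain \<psi> :: "'a \<Rightarrow> real" where \<psi>: "bounded_linear \<psi>" "\<And>a. \<psi> (star a) = \<psi> a"
    "\<And>g a. \<psi> (\<alpha> g a) = \<psi> a" "\<And>b. b \<in> fixed_system \<alpha> \<Longrightarrow> \<psi> b = 0" "\<exists>a. \<psi> a \<noteq> 0"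
    by (rule invariant_annihilator) blast
  obtain h where h: "linear h" "\<And>a. h (star a) = h a" "\<And>g a. h (\<alpha> g a) = h a"
    "\<And>a. a \<in> pos_cone \<Longrightarrow> h a \<ge> 0" "\<And>a. a \<in> pos_cone \<Longrightarrow> \<psi> a \<le> h a"
    using invariant_positive_majorant[OF \<psi>(1-3)] by blast
  note lin\<psi> = linear_add[OF bounded_linear.linear[OF \<psi>(1)]] linear_scale[OF bounded_linear.linear[OF \<psi>(1)]]
    linear_diff[OF bounded_linear.linear[OF \<psi>(1)]]
  note linh = linear_add[OF h(1)] linear_scale[OF h(1)] linear_diff[OF h(1)]
  have one: "1 \<in> fixed_system \<alpha>" by (simp add: fixed_system_def unital)
  then have \<psi>1: "\<psi> 1 = 0" by (rule \<psi>(4))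
  have "h 1 \<ge> 0" using cone_one_scale[of 1] by (intro h(4)) simp
  show False
  proof (cases "h 1 = 0")
    \<comment> \<open>The degenerate case: a positive functional with h 1 = 0 vanishes on the cone,
      so \<psi> \<le> 0 there. As \<psi> 1 = 0, the positive elements norm a - a and norm a + a then
      force \<psi> a = 0 for self-adjoint a.\<close>
    case True
    have cone0: "\<psi> a \<le> 0" if "a \<in> pos_cone" for a
    proof -
      have "norm a *\<^sub>R 1 - a \<in> pos_cone"
        using that by (intro norm_bound_minus_in_cone) (simp_all add: cone_selfadjoint)
      from h(4)[OF this] True have "h a \<le> 0" by (simp add: linh)
      then show ?thesis using h(5)[OF that] by simp
    qed
    have sa: "\<psi> a = 0" if "star a = a" for a
    proof -
      have "norm a *\<^sub>R 1 - a \<in> pos_cone" "norm a *\<^sub>R 1 - (- a) \<in> pos_cone"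
        using that by (intro norm_bound_minus_in_cone; simp add: star_minus)+
      from this[THEN cone0] show ?thesis by (simp add: lin\<psi> \<psi>1)
    qed
    have "\<psi> a = \<psi> (re_part a)" for a by (simp add: re_part_def lin\<psi> \<psi>(2))
    then have "\<psi> a = 0" for a using sa by simp
    then show False using \<psi>(5) by blast
  next
    case False
    with \<open>h 1 \<ge> 0\<close> have pos: "h 1 > 0" by simp
    \<comment> \<open>One factor h 1 normalises both parts, because \<psi> 1 = 0.\<close>
    define u v where "u = (\<lambda>a. h a / h 1)" and "v = (\<lambda>a. (h a - \<psi> a) / h 1)"
    have u: "state_on UNIV (complexification u)"
    proof (rule complexification_state)
      show "linear u" unfolding u_def by (rule linearI) (simp_all add: linh add_divide_distrib)
    qed (use pos h in \<open>simp_all add: u_def\<close>)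
    have v: "state_on UNIV (complexification v)"
    proof (rule complexification_state)
      show "linear v" unfolding v_def
        by (rule linearI) (simp_all add: linh lin\<psi> add_divide_distrib diff_divide_distrib right_diff_distrib)
    qed (use pos h \<psi> \<psi>1 in \<open>simp_all add: v_def\<close>)
    have inv: "right_invariant_map \<alpha> (complexification u)" "right_invariant_map \<alpha> (complexification v)"
      using h(3) \<psi>(3) unfolding right_invariant_map_def
      by (auto simp: fun_eq_iff complexification_def u_def v_def simp flip: action_simps)
    \<comment> \<open>Both b and i b are tested, since the imaginary part of
      \<open>complexification\<close> at b is a value at i b.\<close>
    have agree: "complexification u b = complexification v b" if "b \<in> fixed_system \<alpha>" for b
      using \<psi>(4)[OF that] \<psi>(4)[OF fixed_subspace(3)[OF that, of \<i>]]
      by (simp add: complexification_def u_def v_def)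
    have "state_on (fixed_system \<alpha>) (complexification v)"
      using v by (auto simp: state_on_def clinear_on_def)
    with assms have "\<exists>!\<nu>. state_on UNIV \<nu> \<and> right_invariant_map \<alpha> \<nu> \<and>
        (\<forall>b\<in>fixed_system \<alpha>. \<nu> b = complexification v b)"
      by (simp add: uniquely_ergodic_rel_fixed_def)
    then have "complexification u = complexification v" using u v inv agree by blast
    then have "u a = v a" for a by (metis complexification_def complex.sel(1))
    then have "\<psi> a = 0" for a using pos by (simp add: u_def v_def field_simps)
    then show False using \<psi>(5) by blast
  qed
qed

lemma dense_imp_averages_converge:
  assumes "dense_decomposition \<alpha>"
  shows "averages_converge \<rho> I le f \<alpha>"
  unfolding averages_converge_def
proof
  fix a
  have coboundary_lim: "(average y \<longlongrightarrow> 0) (net_filter I le)" if "y \<in> cspan (coboundaries \<alpha>)" for y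
    using that
  proof (induction rule: complex_vector.span_induct_alt)
    case base
    have "\<forall>\<^sub>F i in net_filter I le. average 0 i = 0"
      using eventually_index by (rule eventually_mono) (rule average_fixed, simp_all add: fixed_subspace)
    then show ?case by (rule tendsto_eventually)
  next
    case (step c x y)
    then obtain g b where x: "x = b - \<alpha> g b" by (auto simp: coboundaries_def)
    have "((\<lambda>i. c *\<^sub>C average x i + average y i) \<longlongrightarrow> c *\<^sub>C 0 + 0) (net_filter I le)"
      unfolding x
      by (intro tendsto_add bounded_linear.tendsto[OF bounded_linear_scaleC] right_net_average step(2))
    moreover have "\<forall>\<^sub>F i in net_filter I le. c *\<^sub>C average x i + average y i = average (c *\<^sub>C x + y) i"
      using eventually_index by (rule eventually_mono) (simp add: average_add average_scaleC)
    ultimately show ?case using tendsto_cong by fastforce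
  qed
  have fixed_lim: "(average x \<longlongrightarrow> x) (net_filter I le)" if "x \<in> fixed_system \<alpha>" for x
    using eventually_index that by (intro tendsto_eventually) (auto elim: eventually_mono simp: average_fixed)
  have lim: "(average (x + y) \<longlongrightarrow> x + 0) (net_filter I le)"
    if "x \<in> fixed_system \<alpha>" "y \<in> cspan (coboundaries \<alpha>)" for x y
  proof -
    have "((\<lambda>i. average x i + average y i) \<longlongrightarrow> x + 0) (net_filter I le)"
      by (intro tendsto_add fixed_lim coboundary_lim that)
    moreover have "\<forall>\<^sub>F i in net_filter I le. average x i + average y i = average (x + y) i"
      using eventually_index by (rule eventually_mono) (simp add: average_add)
    ultimately show ?thesis using tendsto_cong by fastforce
  qed
  have "a \<in> closure {x + y | x y. x \<in> fixed_system \<alpha> \<and> y \<in> cspan (coboundaries \<alpha>)}"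
    using assms by (simp add: dense_decomposition_def)
  then obtain b where b: "\<And>n. b n \<in> {x + y | x y. x \<in> fixed_system \<alpha> \<and> y \<in> cspan (coboundaries \<alpha>)}"
    "b \<longlonglongrightarrow> a" unfolding closure_sequential by blast
  have "\<exists>l. (average (b n) \<longlongrightarrow> l) (net_filter I le)" for n
  proof -
    obtain x y where "b n = x + y" "x \<in> fixed_system \<alpha>" "y \<in> cspan (coboundaries \<alpha>)"
      using b(1)[of n] by blast
    then show ?thesis using lim by metis
  qed
  then obtain l where l: "\<And>n. (average (b n) \<longlongrightarrow> l n) (net_filter I le)" by metis
  \<comment> \<open>Averages contract, so the limits l n are no further apart than the approximants
    b n; completeness then supplies the candidate L.\<close>
  have dist_l: "dist (l m) (l n) \<le> dist (b m) (b n)" for m n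
  proof (rule tendsto_upperbound[OF tendsto_dist[OF l l] _ net_filter_nontrivial])
    show "\<forall>\<^sub>F i in net_filter I le. dist (average (b m) i) (average (b n) i) \<le> dist (b m) (b n)"
      using eventually_index by (rule eventually_mono)
        (simp add: dist_norm norm_average_le flip: average_diff)
  qed
  have "Cauchy b" by (rule LIMSEQ_imp_Cauchy[OF b(2)])
  then have "Cauchy l" unfolding Cauchy_def using dist_l by (meson le_less_trans)
  then obtain L where L: "l \<longlonglongrightarrow> L" using Cauchy_convergent convergent_def by blast
  have "(average a \<longlongrightarrow> L) (net_filter I le)"
  proof (rule tendstoI)
    fix e :: real assume e: "e > 0"
    have "\<forall>\<^sub>F n in sequentially. dist (b n) a < e / 3 \<and> dist (l n) L < e / 3"
      using tendstoD[OF b(2), of "e / 3"] tendstoD[OF L, of "e / 3"] e by (auto intro: eventually_conj)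
    then obtain n where n: "dist (b n) a < e / 3" "dist (l n) L < e / 3"
      using eventually_happens'[OF sequentially_bot] by blast
    have "\<forall>\<^sub>F i in net_filter I le. dist (average (b n) i) (l n) < e / 3"
      using tendstoD[OF l, of "e / 3" n] e by simp
    with eventually_index show "\<forall>\<^sub>F i in net_filter I le. dist (average a i) L < e"
    proof eventually_elim
      case (elim i)
      have "dist (average a i) (average (b n) i) \<le> dist (b n) a"
        using norm_average_le[OF elim(1), of "a - b n"] average_diff[OF elim(1), of a "b n"]
        by (simp add: dist_norm norm_minus_commute)
      then show ?case
        using n elim(2) dist_triangle[of "average a i" L "average (b n) i"]
          dist_triangle[of "average (b n) i" L "l n"] by linarith
    qed
  qed
  then show "\<exists>l. (average a \<longlongrightarrow> l) (net_filter I le)" by blast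
qed

lemma closed_imp_dense:
  assumes "closed_decomposition \<alpha>"
  shows "dense_decomposition \<alpha>"
proof -
  have "a \<in> closure {x + y | x y. x \<in> fixed_system \<alpha> \<and> y \<in> cspan (coboundaries \<alpha>)}" for a
  proof -
    obtain x y where xy: "a = x + y" "x \<in> fixed_system \<alpha>" "y \<in> closure (cspan (coboundaries \<alpha>))"
      using assms unfolding closed_decomposition_def by blast
    then obtain s where s: "\<And>n. s n \<in> cspan (coboundaries \<alpha>)" "s \<longlonglongrightarrow> y"
      unfolding closure_sequential by blast
    have "(\<lambda>n. x + s n) \<longlonglongrightarrow> a" unfolding xy(1) by (intro tendsto_intros s(2))
    moreover have "x + s n \<in> {x + y | x y. x \<in> fixed_system \<alpha> \<and> y \<in> cspan (coboundaries \<alpha>)}" for n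
      using xy(2) s(1) by blast
    ultimately show ?thesis unfolding closure_sequential by (intro exI[of _ "\<lambda>n. x + s n"]) simp
  qed
  then show ?thesis by (auto simp: dense_decomposition_def)
qed

text \<open>States separate points, so weak limits suffice for identities of E, with the left and
  the right net condition each giving one kind of invariance. The unique invariant extension of a
  state \<mu> is its composition with E.\<close>

lemma weak_average_projection_properties:
  assumes w: "weak_average_projection \<rho> I le f \<alpha> B E"
  shows "B = fixed_system \<alpha>" "\<alpha> g (E a) = E a" "E (\<alpha> g a) = E a" "uniquely_ergodic_rel_fixed \<alpha>"
proof -
  have E: "clinear_on UNIV E" "\<And>a. cstar_positive a \<Longrightarrow> cstar_positive (E a)"
    "\<And>a. E (E a) = E a" "range E = B" "1 \<in> B"
    using w by (auto simp: weak_average_projection_def positive_projection_onto_def operator_system_def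
        fun_eq_iff)
  have lim: "((\<lambda>i. \<phi> (average a i)) \<longlongrightarrow> \<phi> (E a)) (net_filter I le)" if \<phi>: "state_on UNIV \<phi>" for \<phi> a
  proof -
    have "((\<lambda>i. (\<integral>g. f i g *\<^sub>R \<phi> (\<alpha> g a) \<partial>\<rho>) /\<^sub>R (\<integral>g. f i g \<partial>\<rho>)) \<longlongrightarrow> \<phi> (E a)) (net_filter I le)"
      using w \<phi> by (simp add: weak_average_projection_def)
    moreover have "\<forall>\<^sub>F i in net_filter I le.
        (\<integral>g. f i g *\<^sub>R \<phi> (\<alpha> g a) \<partial>\<rho>) /\<^sub>R (\<integral>g. f i g \<partial>\<rho>) = \<phi> (average a i)"
      using eventually_index
      by (rule eventually_mono) (rule functional_average(2)[OF _ state_bounded_linear[OF \<phi>], symmetric])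
    ultimately show ?thesis by (rule Lim_transform_eventually)
  qed
  note unique = tendsto_unique[OF net_filter_nontrivial]
  \<comment> \<open>Invariance is asked at the point a only: this serves invariant states at every
    a, and arbitrary states at fixed points.\<close>
  have \<phi>E: "\<phi> (E a) = \<phi> a" if "state_on UNIV \<phi>" "\<And>g. \<phi> (\<alpha> g a) = \<phi> a" for \<phi> a
  proof (rule unique[OF lim[OF that(1)] tendsto_eventually])
    show "\<forall>\<^sub>F i in net_filter I le. \<phi> (average a i) = \<phi> a"
      using eventually_index
      by (rule eventually_mono) (rule invariant_map_average[OF _ state_bounded_linear[OF that(1)] that(2)])
  qed
  show fixedE: "\<alpha> g (E a) = E a" for g a
  proof (rule states_separate)
    fix \<phi> :: "'a \<Rightarrow> complex" assume \<phi>: "state_on UNIV \<phi>"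
    \<comment> \<open>The composition of \<phi> with \<alpha> g is again a state, so the weak limit
      is available for it too.\<close>
    then have \<phi>': "state_on UNIV (\<lambda>x. \<phi> (\<alpha> g x))"
      using action_cone by (simp add: state_on_def clinear_on_def action_simps unital cstar_positive_iff_cone)
    have "((\<lambda>i. \<phi> (average a i - \<alpha> g (average a i))) \<longlongrightarrow> \<phi> 0) (net_filter I le)"
      by (rule bounded_linear.tendsto[OF state_bounded_linear[OF \<phi>] left_net_average])
    moreover have "((\<lambda>i. \<phi> (average a i) - \<phi> (\<alpha> g (average a i))) \<longlongrightarrow> \<phi> (E a) - \<phi> (\<alpha> g (E a)))
        (net_filter I le)"
      by (intro tendsto_diff lim[OF \<phi>] lim[OF \<phi>'])
    ultimately have "\<phi> 0 = \<phi> (E a) - \<phi> (\<alpha> g (E a))"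
      by (intro unique) (simp_all add: clinear_on_simps[OF state_clinear[OF \<phi>]])
    then show "\<phi> (\<alpha> g (E a)) = \<phi> (E a)" by (simp add: clinear_on_simps[OF state_clinear[OF \<phi>]])
  qed
  show invE: "E (\<alpha> g a) = E a" for g a
  proof (rule states_separate)
    fix \<phi> :: "'a \<Rightarrow> complex" assume \<phi>: "state_on UNIV \<phi>"
    have "((\<lambda>i. \<phi> (average (a - \<alpha> g a) i)) \<longlongrightarrow> \<phi> 0) (net_filter I le)"
      by (rule bounded_linear.tendsto[OF state_bounded_linear[OF \<phi>] right_net_average])
    then have "\<phi> 0 = \<phi> (E (a - \<alpha> g a))" by (rule unique[OF _ lim[OF \<phi>]])
    then show "\<phi> (E (\<alpha> g a)) = \<phi> (E a)"
      by (simp add: clinear_on_simps[OF state_clinear[OF \<phi>]] clinear_on_simps[OF E(1)])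
  qed
  have E_fixed: "E a = a" if "a \<in> fixed_system \<alpha>" for a
    by (rule states_separate, rule \<phi>E) (use that in \<open>auto simp: fixed_system_def\<close>)
  show B: "B = fixed_system \<alpha>"
  proof
    show "B \<subseteq> fixed_system \<alpha>" using fixedE by (auto simp: fixed_system_def simp flip: E(4))
    show "fixed_system \<alpha> \<subseteq> B" using E_fixed E(4) by (metis rangeI subsetI)
  qed
  show "uniquely_ergodic_rel_fixed \<alpha>"
    unfolding uniquely_ergodic_rel_fixed_def
  proof (intro allI impI)
    fix \<mu> assume \<mu>: "state_on (fixed_system \<alpha>) \<mu>"
    have inF: "E a \<in> fixed_system \<alpha>" for a using E(4) B by blast
    show "\<exists>!\<nu>. state_on UNIV \<nu> \<and> right_invariant_map \<alpha> \<nu> \<and> (\<forall>b\<in>fixed_system \<alpha>. \<nu> b = \<mu> b)"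
    proof (rule ex1I[of _ "\<lambda>a. \<mu> (E a)"], intro conjI ballI)
      show "state_on UNIV (\<lambda>a. \<mu> (E a))"
        using \<mu> inF E(2) E_fixed[of 1] E(5) B
        by (simp add: state_on_def clinear_on_def clinear_on_simps[OF E(1)])
      show "right_invariant_map \<alpha> (\<lambda>a. \<mu> (E a))" by (simp add: right_invariant_map_def fun_eq_iff invE)
      show "\<mu> (E b) = \<mu> b" if "b \<in> fixed_system \<alpha>" for b by (simp add: E_fixed that)
    next
      fix \<nu> assume \<nu>: "state_on UNIV \<nu> \<and> right_invariant_map \<alpha> \<nu> \<and> (\<forall>b\<in>fixed_system \<alpha>. \<nu> b = \<mu> b)"
      then have "\<nu> (E a) = \<nu> a" for a
        by (intro \<phi>E) (auto simp: right_invariant_map_def fun_eq_iff)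
      moreover have "\<nu> (E a) = \<mu> (E a)" for a using \<nu> inF by blast
      ultimately show "\<nu> = (\<lambda>a. \<mu> (E a))" by auto
    qed
  qed
qed

lemma limit_projection:
  assumes "averages_converge \<rho> I le f \<alpha>"
  obtains E where "\<And>a. (average a \<longlongrightarrow> E a) (net_filter I le)" "clinear_on UNIV E"
    "\<And>a. norm (E a) \<le> norm a" "\<And>a. a \<in> pos_cone \<Longrightarrow> E a \<in> pos_cone"
    "\<And>a. E a \<in> fixed_system \<alpha>" "\<And>b. b \<in> fixed_system \<alpha> \<Longrightarrow> E b = b" "\<And>g a. E (\<alpha> g a) = E a"
proof -
  obtain E where lim: "\<And>a. (average a \<longlongrightarrow> E a) (net_filter I le)"
    using assms unfolding averages_converge_def by metis
  note unique = tendsto_unique[OF net_filter_nontrivial]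
  \<comment> \<open>Carries an identity that holds at every index over to the limit.\<close>
  have transfer: "l = E b" if "((\<lambda>i. F i) \<longlongrightarrow> l) (net_filter I le)" "\<And>i. i \<in> I \<Longrightarrow> F i = average b i" for F l b
  proof (rule unique[OF that(1)])
    have "\<forall>\<^sub>F i in net_filter I le. average b i = F i"
      using eventually_index by (rule eventually_mono) (simp add: that(2))
    then show "(F \<longlongrightarrow> E b) (net_filter I le)" by (rule Lim_transform_eventually[OF lim])
  qed
  have lin: "clinear_on UNIV E" unfolding clinear_on_def
  proof (intro conjI allI ballI)
    show "E (a + b) = E a + E b" for a b
      by (rule transfer[symmetric, OF tendsto_add[OF lim lim]]) (simp add: average_add)
    show "E (c *\<^sub>C a) = c *\<^sub>C E a" for c a
      by (rule transfer[symmetric, OF bounded_linear.tendsto[OF bounded_linear_scaleC lim]])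
        (simp add: average_scaleC)
  qed
  note simps = clinear_on_simps[OF lin]
  show thesis
  proof (rule that[OF lim lin])
    show "norm (E a) \<le> norm a" for a
      by (rule tendsto_upperbound[OF tendsto_norm[OF lim] _ net_filter_nontrivial])
        (use eventually_index in \<open>auto elim: eventually_mono simp: norm_average_le\<close>)
    show "E a \<in> pos_cone" if "a \<in> pos_cone" for a
      by (rule Lim_in_closed_set[OF closed_cone _ net_filter_nontrivial lim])
        (use eventually_index that in \<open>auto elim: eventually_mono simp: average_cone\<close>)
    have "\<alpha> g (E a) = E a" for g a
    proof -
      have "((\<lambda>i. average a i - \<alpha> g (average a i)) \<longlongrightarrow> E a - \<alpha> g (E a)) (net_filter I le)"
        by (intro tendsto_diff bounded_linear.tendsto[OF action_bounded_linear] lim)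
      from unique[OF this left_net_average] show ?thesis by simp
    qed
    then show "E a \<in> fixed_system \<alpha>" for a by (simp add: fixed_system_def)
    show "E b = b" if "b \<in> fixed_system \<alpha>" for b
      by (rule transfer[symmetric, OF tendsto_const]) (simp add: average_fixed that)
    show "E (\<alpha> g a) = E a" for g a
      using unique[OF lim right_net_average, of a g] by (simp add: simps)
  qed
qed

text \<open>A continuous invariant map does not see averaging. This determines the kernel of the
  limit projection and gives uniqueness of extensions and of invariant projections.\<close>

lemma invariant_map_limit:
  fixes T :: "'a \<Rightarrow> 'b::real_normed_vector"
  assumes lim: "(average a \<longlongrightarrow> l) (net_filter I le)"
    and T: "bounded_linear T" "\<And>g. T (\<alpha> g a) = T a"
  shows "T l = T a"
proof (rule tendsto_unique[OF net_filter_nontrivial bounded_linear.tendsto[OF T(1) lim] tendsto_eventually])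
  show "\<forall>\<^sub>F i in net_filter I le. T (average a i) = T a"
    using eventually_index by (rule eventually_mono) (rule invariant_map_average[OF _ T])
qed

lemma averages_converge_imp_closed:
  assumes "averages_converge \<rho> I le f \<alpha>"
  shows "closed_decomposition \<alpha>"
proof -
  obtain E where E: "\<And>a. (average a \<longlongrightarrow> E a) (net_filter I le)" "\<And>a. E a \<in> fixed_system \<alpha>"
    using limit_projection[OF assms] by metis
  have "a - E a \<in> closure (cspan (coboundaries \<alpha>))" for a
  proof (rule ccontr)
    assume "a - E a \<notin> closure (cspan (coboundaries \<alpha>))"
    then obtain k :: "'a \<Rightarrow> real" where k: "bounded_linear k"
      "\<And>x. x \<in> cspan (coboundaries \<alpha>) \<Longrightarrow> k x = 0" "k (a - E a) \<noteq> 0"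
      using annihilating_functional[OF complex_subspace_imp_subspace[OF coboundary_subspace]] by metis
    note lin = linear_diff[OF bounded_linear.linear[OF k(1)]]
    have "k (\<alpha> g a) = k a" for g using k(2)[OF coboundary_in_span, of a g] by (simp add: lin)
    then have "k (E a) = k a" by (rule invariant_map_limit[OF E(1) k(1)])
    then show False using k(3) by (simp add: lin)
  qed
  then have "\<exists>x y. a = x + y \<and> x \<in> fixed_system \<alpha> \<and> y \<in> closure (cspan (coboundaries \<alpha>))" for a
    using E(2) by (intro exI[of _ "E a"] exI[of _ "a - E a"]) simp
  then show ?thesis unfolding closed_decomposition_def by blast
qed

lemma averages_converge_imp_weak_average_projection:
  assumes "averages_converge \<rho> I le f \<alpha>"
  shows "\<exists>B E. weak_average_projection \<rho> I le f \<alpha> B E"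
proof -
  obtain E where E: "\<And>a. (average a \<longlongrightarrow> E a) (net_filter I le)" "clinear_on UNIV E"
    "\<And>a. a \<in> pos_cone \<Longrightarrow> E a \<in> pos_cone" "\<And>a. E a \<in> fixed_system \<alpha>"
    "\<And>b. b \<in> fixed_system \<alpha> \<Longrightarrow> E b = b"
    using limit_projection[OF assms] by metis
  have "range E = fixed_system \<alpha>"
  proof
    show "range E \<subseteq> fixed_system \<alpha>" using E(4) by blast
    show "fixed_system \<alpha> \<subseteq> range E" using E(5) by (metis rangeI subsetI)
  qed
  then have "positive_projection_onto (fixed_system \<alpha>) E"
    using E(2-5) by (simp add: positive_projection_onto_def cstar_positive_iff_cone fun_eq_iff)
  moreover have "((\<lambda>i. (\<integral>g. f i g *\<^sub>R \<phi> (\<alpha> g a) \<partial>\<rho>) /\<^sub>R (\<integral>g. f i g \<partial>\<rho>)) \<longlongrightarrow> \<phi> (E a))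
      (net_filter I le)" if \<phi>: "state_on UNIV \<phi>" for \<phi> a
  proof (rule Lim_transform_eventually[OF bounded_linear.tendsto[OF state_bounded_linear[OF \<phi>] E(1)]])
    show "\<forall>\<^sub>F i in net_filter I le.
        \<phi> (average a i) = (\<integral>g. f i g *\<^sub>R \<phi> (\<alpha> g a) \<partial>\<rho>) /\<^sub>R (\<integral>g. f i g \<partial>\<rho>)"
      using eventually_index
      by (rule eventually_mono) (rule functional_average(2)[OF _ state_bounded_linear[OF \<phi>]])
  qed
  ultimately have "weak_average_projection \<rho> I le f \<alpha> (fixed_system \<alpha>) E"
    by (simp add: weak_average_projection_def fixed_operator_system)
  then show ?thesis by blast
qed

section \<open>Norm-preserving extensions and invariant projections\<close>

lemma functional_norm_on_unit_ball:
  assumes "bounded_functional_on B \<omega>" "a \<in> B" "norm a \<le> 1"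
  shows "cmod (\<omega> a) \<le> functional_norm_on B \<omega>"
proof -
  obtain K where K: "\<And>a. a \<in> B \<Longrightarrow> cmod (\<omega> a) \<le> K * norm a"
    using assms(1) by (auto simp: bounded_functional_on_def)
  \<comment> \<open>The constant K comes without a sign, hence the maximum with 0.\<close>
  have "cmod (\<omega> b) \<le> max K 0" if "b \<in> B" "norm b \<le> 1" for b
    using K[OF that(1)] mult_mono[of K "max K 0" "norm b" 1] that(2) by simp
  then have "bdd_above ((\<lambda>a. cmod (\<omega> a)) ` {a \<in> B. norm a \<le> 1})" by (intro bdd_aboveI2) auto
  then show ?thesis unfolding functional_norm_on_def using assms(2,3) by (intro cSUP_upper) auto
qed

lemma functional_norm_on_le:
  assumes "0 \<in> B" "\<And>a. a \<in> B \<Longrightarrow> norm a \<le> 1 \<Longrightarrow> cmod (\<omega> a) \<le> K"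
  shows "functional_norm_on B \<omega> \<le> K"
  unfolding functional_norm_on_def using assms by (intro cSUP_least) auto

lemma bounded_functional_norm_bound:
  assumes \<eta>: "bounded_functional_on UNIV \<eta>"
  shows "cmod (\<eta> a) \<le> functional_norm_on UNIV \<eta> * norm a"
proof (cases "a = 0")
  case True
  then show ?thesis using \<eta> clinear_on_simps(4)[of \<eta>] by (simp add: bounded_functional_on_def)
next
  case False
  have "cmod (\<eta> ((1 / norm a) *\<^sub>R a)) \<le> functional_norm_on UNIV \<eta>"
    by (rule functional_norm_on_unit_ball[OF \<eta>]) (use False in simp_all)
  then show ?thesis
    using \<eta> False by (simp add: bounded_functional_on_def clinear_on_simps(3) divide_le_eq mult.commute)
qed

lemma state_functional_norm:
  assumes B: "star_subspace B" and \<mu>: "state_on B \<mu>"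
  shows "bounded_functional_on B \<mu>" "functional_norm_on B \<mu> = 1"
proof -
  have one: "1 \<in> B" "0 \<in> B" using B complex_subspaceD(1) by (auto simp: star_subspace_def)
  show bf: "bounded_functional_on B \<mu>"
    unfolding bounded_functional_on_def using \<mu> state_on_norm_le[OF B \<mu>]
    by (auto simp: state_on_def intro!: exI[of _ 1])
  have "functional_norm_on B \<mu> \<le> 1"
    by (rule functional_norm_on_le[OF one(2)]) (use state_on_norm_le[OF B \<mu>] order_trans in blast)
  moreover have "1 \<le> functional_norm_on B \<mu>"
    using functional_norm_on_unit_ball[OF bf one(1)] \<mu> by (simp add: state_on_def)
  ultimately show "functional_norm_on B \<mu> = 1" by simp
qed

text \<open>The extension is \<omega> composed with E; its norm is that of \<omega> because E is a
  contraction onto the fixed points. Any bounded invariant \<eta> equals its own composition with E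
  and is thus determined by its values on the fixed points.\<close>

lemma averages_converge_imp_unique_extension:
  assumes "averages_converge \<rho> I le f \<alpha>"
  shows "unique_norm_preserving_extension \<alpha>"
  unfolding unique_norm_preserving_extension_def
proof (intro allI impI)
  fix \<omega> assume \<omega>: "bounded_functional_on (fixed_system \<alpha>) \<omega>"
  obtain E where E: "\<And>a. (average a \<longlongrightarrow> E a) (net_filter I le)" "clinear_on UNIV E"
    "\<And>a. norm (E a) \<le> norm a" "\<And>a. E a \<in> fixed_system \<alpha>"
    "\<And>b. b \<in> fixed_system \<alpha> \<Longrightarrow> E b = b" "\<And>g a. E (\<alpha> g a) = E a"
    using limit_projection[OF assms] by metis
  obtain K where K: "\<And>a. a \<in> fixed_system \<alpha> \<Longrightarrow> cmod (\<omega> a) \<le> K * norm a"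
    using \<omega> by (auto simp: bounded_functional_on_def)
  let ?\<eta> = "\<lambda>a. \<omega> (E a)"
  have "cmod (?\<eta> a) \<le> max K 0 * norm a" for a
    using order_trans[OF K[OF E(4)] mult_mono[OF max.cobounded1[of K 0] E(3)]] by simp
  moreover have "clinear_on UNIV ?\<eta>"
    using \<omega> E(4) by (simp add: bounded_functional_on_def clinear_on_def clinear_on_simps[OF E(2)])
  ultimately have bf: "bounded_functional_on UNIV ?\<eta>" unfolding bounded_functional_on_def by blast
  show "\<exists>!\<eta>. bounded_functional_on UNIV \<eta> \<and> right_invariant_map \<alpha> \<eta> \<and>
      (\<forall>b\<in>fixed_system \<alpha>. \<eta> b = \<omega> b) \<and>
      functional_norm_on UNIV \<eta> = functional_norm_on (fixed_system \<alpha>) \<omega>"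
  proof (rule ex1I[of _ ?\<eta>], intro conjI ballI)
    show "right_invariant_map \<alpha> ?\<eta>" by (simp add: right_invariant_map_def fun_eq_iff E(6))
    show "functional_norm_on UNIV ?\<eta> = functional_norm_on (fixed_system \<alpha>) \<omega>"
    proof (rule antisym)
      show "functional_norm_on UNIV ?\<eta> \<le> functional_norm_on (fixed_system \<alpha>) \<omega>"
        by (rule functional_norm_on_le)
          (use functional_norm_on_unit_ball[OF \<omega> E(4)] order_trans[OF E(3)] in auto)
      show "functional_norm_on (fixed_system \<alpha>) \<omega> \<le> functional_norm_on UNIV ?\<eta>"
      proof (rule functional_norm_on_le[OF fixed_subspace(1)])
        show "cmod (\<omega> b) \<le> functional_norm_on UNIV ?\<eta>"
          if "b \<in> fixed_system \<alpha>" "norm b \<le> 1" for b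
          using functional_norm_on_unit_ball[OF bf UNIV_I that(2)] by (simp add: E(5)[OF that(1)])
      qed
    qed
  next
    fix \<eta> assume \<eta>: "bounded_functional_on UNIV \<eta> \<and> right_invariant_map \<alpha> \<eta> \<and>
      (\<forall>b\<in>fixed_system \<alpha>. \<eta> b = \<omega> b) \<and>
      functional_norm_on UNIV \<eta> = functional_norm_on (fixed_system \<alpha>) \<omega>"
    then have "bounded_linear \<eta>"
      by (intro clinear_bounded_linear[OF _ bounded_functional_norm_bound])
        (auto simp: bounded_functional_on_def)
    then have "\<eta> (E a) = \<eta> a" for a
      using \<eta> by (intro invariant_map_limit[OF E(1)]) (auto simp: right_invariant_map_def fun_eq_iff)
    moreover have "\<eta> (E a) = \<omega> (E a)" for a using \<eta> E(4) by blast
    ultimately show "\<eta> = ?\<eta>" by auto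
  qed (simp_all add: bf E(5))
qed

text \<open>A functional that extends \<mu> takes the value 1 at the unit, so it is a state exactly
  if it is bounded of norm 1. The two uniqueness statements for \<mu> therefore concern the same set
  of extensions.\<close>

lemma unique_extension_imp_uniquely_ergodic:
  assumes "unique_norm_preserving_extension \<alpha>"
  shows "uniquely_ergodic_rel_fixed \<alpha>"
  unfolding uniquely_ergodic_rel_fixed_def
proof (intro allI impI)
  fix \<mu> assume \<mu>: "state_on (fixed_system \<alpha>) \<mu>"
  note \<mu>_norm = state_functional_norm[OF fixed_star_subspace \<mu>]
  have one: "1 \<in> fixed_system \<alpha>" using fixed_star_subspace by (simp add: star_subspace_def)
  have iff: "state_on UNIV \<nu> \<longleftrightarrow> bounded_functional_on UNIV \<nu> \<and> functional_norm_on UNIV \<nu> = 1"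
    if "\<forall>b\<in>fixed_system \<alpha>. \<nu> b = \<mu> b" for \<nu>
  proof
    assume "state_on UNIV \<nu>"
    then show "bounded_functional_on UNIV \<nu> \<and> functional_norm_on UNIV \<nu> = 1"
      using state_functional_norm[OF star_subspace_UNIV] by blast
  next
    assume \<nu>: "bounded_functional_on UNIV \<nu> \<and> functional_norm_on UNIV \<nu> = 1"
    show "state_on UNIV \<nu>"
    proof (rule contractive_unital_functional_state)
      show "clinear_on UNIV \<nu>" using \<nu> by (simp add: bounded_functional_on_def)
      show "cmod (\<nu> a) \<le> norm a" for a using bounded_functional_norm_bound[of \<nu> a] \<nu> by simp
      show "\<nu> 1 = 1" using that one \<mu> by (simp add: state_on_def)
    qed
  qed
  have "\<exists>!\<eta>. bounded_functional_on UNIV \<eta> \<and> right_invariant_map \<alpha> \<eta> \<and>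
      (\<forall>b\<in>fixed_system \<alpha>. \<eta> b = \<mu> b) \<and>
      functional_norm_on UNIV \<eta> = functional_norm_on (fixed_system \<alpha>) \<mu>"
    using assms \<mu>_norm(1) by (simp add: unique_norm_preserving_extension_def)
  moreover have "state_on UNIV \<nu> \<and> right_invariant_map \<alpha> \<nu> \<and> (\<forall>b\<in>fixed_system \<alpha>. \<nu> b = \<mu> b) \<longleftrightarrow>
      bounded_functional_on UNIV \<nu> \<and> right_invariant_map \<alpha> \<nu> \<and>
      (\<forall>b\<in>fixed_system \<alpha>. \<nu> b = \<mu> b) \<and>
      functional_norm_on UNIV \<nu> = functional_norm_on (fixed_system \<alpha>) \<mu>" for \<nu>
    using iff[of \<nu>] \<mu>_norm(2) by auto
  ultimately show "\<exists>!\<nu>. state_on UNIV \<nu> \<and> right_invariant_map \<alpha> \<nu> \<and>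
      (\<forall>b\<in>fixed_system \<alpha>. \<nu> b = \<mu> b)" by presburger
qed

text \<open>If P denotes the limit map, invariance and continuity of E give E (P a) = E a, while E
  fixes P a; hence E a = P a.\<close>

lemma invariant_projection_limit:
  assumes E: "invariant_projection \<alpha> E" and conv: "averages_converge \<rho> I le f \<alpha>"
  shows "(average a \<longlongrightarrow> E a) (net_filter I le)"
proof -
  have E': "clinear_on UNIV E" "\<And>a. a \<in> pos_cone \<Longrightarrow> E a \<in> pos_cone" "\<And>a. E (E a) = E a"
    "range E = fixed_system \<alpha>" "\<And>g a. E (\<alpha> g a) = E a"
    using E by (auto simp: invariant_projection_def positive_projection_onto_def
        right_invariant_map_def cstar_positive_iff_cone fun_eq_iff)
  have E_fixed: "E b = b" if "b \<in> fixed_system \<alpha>" for b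
    using that E'(3,4) by (metis imageE)
  have "1 \<in> fixed_system \<alpha>" using fixed_star_subspace by (simp add: star_subspace_def)
  then have "bounded_linear E"
    using positive_unital_map_norm_le[OF E'(1,2)] E_fixed by (intro clinear_bounded_linear[OF E'(1)]) auto
  moreover obtain P where P: "\<And>a. (average a \<longlongrightarrow> P a) (net_filter I le)" "\<And>a. P a \<in> fixed_system \<alpha>"
    using limit_projection[OF conv] by metis
  ultimately have "E (P a) = E a" using E'(5) by (intro invariant_map_limit[OF P(1)])
  then show ?thesis using P(1)[of a] E_fixed[OF P(2), of a] by simp
qed

lemma averages_converge_imp_invariant_projection:
  assumes "averages_converge \<rho> I le f \<alpha>"
  shows "\<exists>!E. invariant_projection \<alpha> E"
proof -
  obtain B E where w: "weak_average_projection \<rho> I le f \<alpha> B E"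
    using averages_converge_imp_weak_average_projection[OF assms] by blast
  note props = weak_average_projection_properties[OF w]
  have E: "invariant_projection \<alpha> E"
    using w props(1,3)
    by (simp add: invariant_projection_def weak_average_projection_def right_invariant_map_def fun_eq_iff)
  show ?thesis
  proof (rule ex1I[of _ E])
    fix E' assume "invariant_projection \<alpha> E'"
    from invariant_projection_limit[OF this assms] invariant_projection_limit[OF E assms]
    show "E' = E" using tendsto_unique[OF net_filter_nontrivial] by blast
  qed (rule E)
qed

end

theorem theorem2p15:
  fixes \<rho> :: "'g::topological_semigroup_mult measure"
    and \<alpha> :: "'g \<Rightarrow> 'a::unital_cstar_algebra \<Rightarrow> 'a"
    and I :: "'i set" and le :: "'i \<Rightarrow> 'i \<Rightarrow> bool" and f :: "'i \<Rightarrow> 'g \<Rightarrow> real"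
  assumes amenable: "amenable_system TYPE('i) \<rho> \<alpha>"
    and unimodular: "left_invariant_measure \<rho>"
    and right_net: "right_averaging_net TYPE('a) \<rho> I le f"
    and left_net: "left_averaging_net TYPE('a) \<rho> I le f"
  shows
    "(uniquely_ergodic_rel_fixed \<alpha> \<longleftrightarrow> averages_converge \<rho> I le f \<alpha>) \<and>
     (uniquely_ergodic_rel_fixed \<alpha> \<longleftrightarrow> dense_decomposition \<alpha>) \<and>
     (uniquely_ergodic_rel_fixed \<alpha> \<longleftrightarrow> closed_decomposition \<alpha>) \<and>
     (uniquely_ergodic_rel_fixed \<alpha> \<longleftrightarrow> unique_norm_preserving_extension \<alpha>) \<and>
     (uniquely_ergodic_rel_fixed \<alpha> \<longleftrightarrow> (\<exists>B E. weak_average_projection \<rho> I le f \<alpha> B E)) \<and>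
     (\<forall>B E. weak_average_projection \<rho> I le f \<alpha> B E \<longrightarrow>
        B = fixed_system \<alpha> \<and> (\<forall>g. \<alpha> g \<circ> E = E \<and> E = E \<circ> \<alpha> g)) \<and>
     (uniquely_ergodic_rel_fixed \<alpha> \<longrightarrow>
        (\<exists>!E. invariant_projection \<alpha> E) \<and>
        (\<forall>E. invariant_projection \<alpha> E \<longrightarrow>
           (\<forall>a. (net_average \<rho> f \<alpha> a \<longlongrightarrow> E a) (net_filter I le))))"
proof -
  interpret averaged_system \<rho> \<alpha> I le f
    using amenable right_net left_net
    by unfold_locales (auto simp: amenable_system_def right_invariant_measure_def)
  have ue_dense: "uniquely_ergodic_rel_fixed \<alpha> \<Longrightarrow> dense_decomposition \<alpha>"
    by (rule uniquely_ergodic_imp_dense)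
  have dense_conv: "dense_decomposition \<alpha> \<Longrightarrow> averages_converge \<rho> I le f \<alpha>"
    by (rule dense_imp_averages_converge)
  have conv_ue: "averages_converge \<rho> I le f \<alpha> \<Longrightarrow> uniquely_ergodic_rel_fixed \<alpha>"
    using averages_converge_imp_weak_average_projection weak_average_projection_properties(4) by blast
  \<comment> \<open>Convergence of the averages is the hub through which the remaining statements
    are compared with unique ergodicity.\<close>
  have ue_conv: "uniquely_ergodic_rel_fixed \<alpha> \<longleftrightarrow> averages_converge \<rho> I le f \<alpha>"
    using ue_dense dense_conv conv_ue by blast
  show ?thesis
  proof (intro conjI)
    show "uniquely_ergodic_rel_fixed \<alpha> \<longleftrightarrow> averages_converge \<rho> I le f \<alpha>" by (rule ue_conv)
    show "uniquely_ergodic_rel_fixed \<alpha> \<longleftrightarrow> dense_decomposition \<alpha>"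
      using ue_dense dense_conv conv_ue by blast
    show "uniquely_ergodic_rel_fixed \<alpha> \<longleftrightarrow> closed_decomposition \<alpha>"
      using ue_conv averages_converge_imp_closed closed_imp_dense dense_conv by blast
    show "uniquely_ergodic_rel_fixed \<alpha> \<longleftrightarrow> unique_norm_preserving_extension \<alpha>"
      using ue_conv averages_converge_imp_unique_extension unique_extension_imp_uniquely_ergodic by blast
    show "uniquely_ergodic_rel_fixed \<alpha> \<longleftrightarrow> (\<exists>B E. weak_average_projection \<rho> I le f \<alpha> B E)"
      using ue_conv averages_converge_imp_weak_average_projection
        weak_average_projection_properties(4) by blast
    show "\<forall>B E. weak_average_projection \<rho> I le f \<alpha> B E \<longrightarrow>
        B = fixed_system \<alpha> \<and> (\<forall>g. \<alpha> g \<circ> E = E \<and> E = E \<circ> \<alpha> g)"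
      using weak_average_projection_properties(1-3) by (force simp: fun_eq_iff)
    show "uniquely_ergodic_rel_fixed \<alpha> \<longrightarrow>
        (\<exists>!E. invariant_projection \<alpha> E) \<and>
        (\<forall>E. invariant_projection \<alpha> E \<longrightarrow>
           (\<forall>a. (net_average \<rho> f \<alpha> a \<longlongrightarrow> E a) (net_filter I le)))"
      using ue_conv averages_converge_imp_invariant_projection invariant_projection_limit by blast
  qed
qed

end
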